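(* Let $(K,v)$ be a valued field and let $w$ be an extension of $v$ to $K(X)$. If $\{Q_i\}_{i\in\Delta}$ is a complete set of abstract key polynomials (ABKPs) for $w$ such that $N$ is the last element of $\Delta$, then, with $w_0=w_{Q_0}$, $$w_0\xrightarrow{Q_1,\gamma_1}w_1\xrightarrow{Q_2,\gamma_2}\cdots\longrightarrow w_{N-1}\xrightarrow{Q_N,\gamma_N}w_N=w$$ is a complete finite Maclane-Vaquié (MLV) chain of $w$ such that, for $0\le j\le N-1$: (i) if $\vartheta_j=\emptyset$, then $w_j\longrightarrow w_{j+1}$ is an ordinary augmentation; further, $w_{j+1}=w_{Q_{j+1}}$ and $\gamma_{j+1}=w(Q_{j+1})$; (ii) if $\vartheta_j\neq\emptyset$, then $w_j\longrightarrow w_{j+1}$ is a limit augmentation; further, $w_{j+1}=w_{Q_{j+1}}$ and $\gamma_{j+1}=w(Q_{j+1})$.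
   Context: Valuations have arbitrary rank. $\overline K$ is a fixed algebraic closure of $K$, $\bar v$ is an extension of $v$ to $\overline K$, and $\overline w$ is a fixed common extension of $w$ and $\bar v$ to $\overline K(X)$. $\Gamma_u$ denotes the value group of $u$. Valuations on $K[X]$ are compared by $u\le u'\iff u(f)\le u'(f)$ for all $f\in K[X]$. ABKPs: for $f\in K[X]$, $\delta(f):=\max\{\overline w(X-\alpha)\mid \alpha\in\overline K,\ f(\alpha)=0\}$. A monic $Q\in K[X]$ is an ABKP for $w$ if $\delta(f)<\delta(Q)$ for every $f\in K[X]$ with $\deg f<\deg Q$ (constants impose no condition). The $Q$-truncation of $w$ is $w_Q(f):=\min_i w(f_iQ^i)$, where $f=\sum_i f_iQ^i$, $\deg f_i<\deg Q$; it is a valuation when $Q$ is an ABKP. Complete set: a family $\Lambda=\{Q_i\}_{i\in\Delta}$ of ABKPs for $w$ is a complete set of ABKPs for $w$ if (i) $\delta(Q_i)\ne\delta(Q_j)$ for every $i\neq j\in\Delta$; (ii) $\Lambda$ is well-ordered with respect to the ordering given by $Q_i<Q_j$ if and only if $\delta(Q_i)<\delta(Q_j)$ for every $i<j\in\Delta$; (iii) for any $f\in K[X]$ there is some $Q_i\in\Lambda$ with $w_{Q_i}(f)=w(f)$. Standing assumption: all complete sets of ABKPs $\{Q_i\}_{i\in\Delta}$ are assumed to satisfy the following properties. (a) $\Delta=\bigcup_{j\in I}\Delta_j$ with $I=\{0,\ldots,N\}$ or $I=\mathbb N\cup\{0\}$, and for each $j\in I$, $\Delta_j=\{j\}\cup\vartheta_j$,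 where $\vartheta_j$ is an ordered set without a maximal element or is empty. (b) $Q_0=X$. (c) For all $j\in I\setminus\{0\}$, $j-1<i<j$ for all $i\in\vartheta_{j-1}$. (d) All $Q_i$ with $i\in\Delta_j$ have the same degree, strictly less than the degree of $Q_{i'}$ for every $i'\in\Delta_{j+1}$. (e) For each $i<i'\in\Delta$, $w(Q_i)<w(Q_{i'})$ and $\delta(Q_i)<\delta(Q_{i'})$. (f) Even though the set $\{Q_i\}_{i\in\Delta}$ is not unique, the cardinality of $I$ and the degree of $Q_i$ for each $i\in I$ are uniquely determined by $w$. (g) $\Delta$ has a maximal element if and only if $I=\{0,\ldots,N\}$ is finite and $\Delta_N=\{N\}$, i.e. $\vartheta_N=\emptyset$. Key polynomials: for a valuation $u$ and $f,g\in K[X]$ write $f\sim_u g$ if $u(f-g)>u(f)=u(g)$; $f\mid_u g$ if $g\sim_u fh$ for some $h\in K[X]$. $f$ is $u$-irreducible if $f\mid_u hq$ implies $f\mid_u h$ or $f\mid_u q$; $f$ is $u$-minimal if $f\mid_u h$ (with $h\ne0$) implies $\deg h\ge\deg f$. $KP(u)$ is the set of key polynomials for $u$, i.e. monic, $u$-irreducible and $u$-minimal polynomials. If $KP(u)\neq\emptyset$, $\deg(u)$ is the minimal degree of a key polynomial for $u$. For $u<u'$, $\Phi_{u,u'}$ is the set of monic $g$ of minimal degree with $u(g)<u'(g)$, and $\deg(\Phi_{u,u'})$ is that degree. Ordinary augmentation: if $\phi\in KP(u)$ and $\gamma>u(\phi)$ lies in a totally ordered abelian group containing $\Gamma_u$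 as an ordered subgroup, then $[u;\phi,\gamma]$ is the valuation $\sum_i f_i\phi^i\mapsto\min_i\{u(f_i)+i\gamma\}$ ($\deg f_i<\deg\phi$). Continuous family of augmentations of $u$: a family $\mathcal W=(\rho_i=[u;\chi_i,\gamma_i])_{i\in\mathbf A}$ of ordinary augmentations of $u$ such that $\mathbf A$ is totally ordered without maximal element; all $\chi_i\in KP(u)$ have the same degree $m=\deg(\mathcal W)$ (stable degree); and for $i<j$ in $\mathbf A$, $\chi_j$ is a key polynomial for $\rho_i$, $\chi_j\not\sim_{\rho_i}\chi_i$ and $\rho_j=[\rho_i;\chi_j,\gamma_j]$. All the $\rho_i$ have the same value group, denoted $\Gamma_{\mathcal W}$. A polynomial $f$ is $\mathcal W$-stable if $\rho_i(f)$ is constant for $i\ge i_0$, for some $i_0\in\mathbf A$; the stable value is $\rho_{\mathcal W}(f)$. Let $m_\infty$ be the minimal degree of a $\mathcal W$-unstable polynomial ($\infty$ if none). $\mathcal W$ is essential if $m<m_\infty<\infty$. $KP_\infty(\mathcal W)$ is the set of monic $\mathcal W$-unstable polynomials of degree $m_\infty$ (MLV limit key polynomials). Limit augmentation: for essential $\mathcal W$, $Q\in KP_\infty(\mathcal W)$ and $\gamma>\rho_i(Q)$ for all $i$, with $\gamma\in\Gamma\cup\{\infty\}$ for a totally ordered abelian group $\Gamma\supseteq\Gamma_{\mathcal W}$, $[\mathcal W;Q,\gamma]$ is the valuation $\sum_i f_iQ^i\mapsto\min_i\{\rho_{\mathcal W}(f_i)+i\gamma\}$ ($\deg f_i<\deg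 Q$). MLV chain: a finite or countably infinite chain $w_0\xrightarrow{\phi_1,\gamma_1}w_1\xrightarrow{\phi_2,\gamma_2}\cdots$ in which each step is either an ordinary augmentation $w_{n+1}=[w_n;\phi_{n+1},\gamma_{n+1}]$, $\phi_{n+1}\in KP(w_n)$, or a limit augmentation $w_{n+1}=[\mathcal W_n;\phi_{n+1},\gamma_{n+1}]$, $\phi_{n+1}\in KP_\infty(\mathcal W_n)$, with $\mathcal W_n$ an essential continuous family of augmentations of $w_n$; here $\phi_0\in KP(w_0)$ is a key polynomial of minimal degree and $\gamma_0=w_0(\phi_0)$; and moreover: for an ordinary step, $\deg(w_n)<\deg(\Phi_{w_n,w_{n+1}})$; for a limit step, $\deg(w_n)=\deg(\Phi_{w_n,w_{n+1}})$ and $\phi_n\notin\Phi_{w_n,w_{n+1}}$. In the chain of the claim, $\phi_j=Q_j$. The chain is complete if $w_0$ is a depth zero valuation, i.e. $w_0(\sum_i c_i(X-a)^i)=\min_i\{v(c_i)+i\gamma\}$ for some $a\in K$ and $\gamma$ in a totally ordered abelian group containing $\Gamma_v$ (or $\gamma=\infty$).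
   Formalization: In (iii) of a complete set, for nonconstant f the Q_i with w_{Q_i}(f)=w(f) must also have deg Q_i ≤ deg f (the claim fails without this), and u-irreducible polynomials are required not to u-divide 1 (otherwise 1 would be a key polynomial). *)

theory Defs
  imports "HOL-Algebra.Algebraic_Closure_Type" "HOL-Library.Extended"
begin

hide_const (open) Polynomials.degree Polynomials.lead_coeff

section \<open>Valuations\<close>

text \<open>
  The ordered group \<open>'g\<close> is arbitrary (so the rank is arbitrary), and valuations take values in
  \<open>\<Gamma> \<union> {\<infinity>}\<close>, with \<open>\<infinity>\<close> rendered as \<^const>\<open>Pinf\<close>; the extra element \<^const>\<open>Minf\<close> of
  \<^typ>\<open>'g extended\<close> is excluded. On a field the axioms force \<open>u x = Pinf\<close> only for \<open>x = 0\<close>; on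
  \<open>K[X]\<close> a nontrivial support is possible, as happens for augmentations with value \<open>\<infinity>\<close>.
  The group \<open>'g\<close> may be strictly larger than any of the value groups involved.
\<close>

definition valuation :: "('a::comm_ring_1 \<Rightarrow> 'g::linordered_ab_group_add extended) \<Rightarrow> bool" where
  "valuation u \<longleftrightarrow>
     (\<forall>x. u x \<noteq> Minf) \<and> u 0 = Pinf \<and> u 1 = 0 \<and>
     (\<forall>x y. u (x * y) = u x + u y) \<and>
     (\<forall>x y. min (u x) (u y) \<le> u (x + y))"

definition on_polys :: "('a::field poly fract \<Rightarrow> 'g extended) \<Rightarrow> 'a poly \<Rightarrow> 'g extended" where
  "on_polys w f = w (to_fract f)"

text \<open>
  \<open>vbar\<close> extends \<open>v\<close> to the algebraic closure, \<open>w\<close> extends \<open>v\<close> to \<open>K(X)\<close>, and \<open>wbar\<close> is a common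
  extension of \<open>w\<close> and \<open>vbar\<close> to the rational function field over the algebraic closure.
\<close>

definition common_extension ::
  "('k::field \<Rightarrow> 'g::linordered_ab_group_add extended) \<Rightarrow> ('k poly fract \<Rightarrow> 'g extended) \<Rightarrow>
   ('k alg_closure \<Rightarrow> 'g extended) \<Rightarrow> ('k alg_closure poly fract \<Rightarrow> 'g extended) \<Rightarrow> bool" where
  "common_extension v w vbar wbar \<longleftrightarrow>
     valuation v \<and> valuation w \<and> valuation vbar \<and> valuation wbar \<and>
     (\<forall>c. w (to_fract [:c:]) = v c) \<and>
     (\<forall>c. vbar (to_ac c) = v c) \<and>
     (\<forall>a. wbar (to_fract [:a:]) = vbar a) \<and>
     (\<forall>p q. q \<noteq> 0 \<longrightarrow>
        wbar (to_fract (map_poly to_ac p) / to_fract (map_poly to_ac q)) =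
        w (to_fract p / to_fract q))"

section \<open>Expansions in powers of a polynomial\<close>

definition expansion_coeff :: "'k::field poly \<Rightarrow> 'k poly \<Rightarrow> nat \<Rightarrow> 'k poly" where
  "expansion_coeff q f i = (f div q ^ i) mod q"

lemma expansion_coeff_sum_aux:
  fixes f q :: "'k::field poly"
  shows "f = (\<Sum>i<n. expansion_coeff q f i * q ^ i) + (f div q ^ n) * q ^ n"
proof (induction n)
  case 0
  then show ?case by simp
next
  case (Suc n)
  have "f div q ^ Suc n = (f div q ^ n) div q"
    using poly_div_mult_right[of f "q ^ n" q] by (simp add: mult.commute)
  moreover have "f div q ^ n = (f div q ^ n) div q * q + (f div q ^ n) mod q"
    by simp
  ultimately have "(f div q ^ n) * q ^ n =
      (f div q ^ Suc n) * q ^ Suc n + expansion_coeff q f n * q ^ n"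
    unfolding expansion_coeff_def
    by (metis (no_types, lifting) distrib_right mult.assoc power_Suc)
  with Suc.IH show ?case
    by (simp add: algebra_simps)
qed

lemma expansion_coeff_degree:
  "degree q > 0 \<Longrightarrow> degree (expansion_coeff q f i) < degree (q :: 'k::field poly)"
  unfolding expansion_coeff_def by (cases "f div q ^ i mod q = 0")
    (auto intro!: degree_mod_less')

lemma expansion_coeff_sum:
  fixes f q :: "'k::field poly"
  assumes "degree q > 0"
  shows "f = (\<Sum>i\<le>degree f. expansion_coeff q f i * q ^ i)"
proof -
  have "q \<noteq> 0" using assms by auto
  then have "degree (q ^ Suc (degree f)) = Suc (degree f) * degree q"
    by (rule degree_power_eq)
  also have "Suc (degree f) \<le> \<dots>"
    using assms mult_le_mono2[of 1 "degree q" "Suc (degree f)"] by simp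
  finally have "degree f < degree (q ^ Suc (degree f))"
    by simp
  then have "f div q ^ Suc (degree f) = 0"
    by (rule div_poly_less)
  with expansion_coeff_sum_aux[of f q "Suc (degree f)"] show ?thesis
    by (simp add: lessThan_Suc_atMost)
qed

text \<open>
  The minimum of \<open>h i f\<^sub>i\<close> over the expansion \<open>f = \<Sum>\<^sub>i f\<^sub>i q\<^sup>i\<close>. As \<open>f\<^sub>i = 0\<close> for \<open>i > degree f\<close> when
  \<open>q\<close> is nonconstant, indices up to \<open>degree f\<close> suffice.
\<close>

definition expansion_min ::
  "(nat \<Rightarrow> 'k::field poly \<Rightarrow> 'g::linorder extended) \<Rightarrow> 'k poly \<Rightarrow> 'k poly \<Rightarrow> 'g extended" where
  "expansion_min h q f = Min ((\<lambda>i. h i (expansion_coeff q f i)) ` {..degree f})"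

definition times_nat :: "nat \<Rightarrow> 'g::linordered_ab_group_add extended \<Rightarrow> 'g extended" where
  "times_nat i \<gamma> = (\<Sum>_<i. \<gamma>)"

definition monic :: "'k::field poly \<Rightarrow> bool" where
  "monic f \<longleftrightarrow> lead_coeff f = 1"

section \<open>Abstract key polynomials\<close>

text \<open>Meaningful for nonconstant \<open>f\<close> only: \<^const>\<open>Max\<close> needs a finite nonempty set of roots.\<close>

definition \<delta> :: "('k::field alg_closure poly fract \<Rightarrow> 'g::linorder extended) \<Rightarrow> 'k poly \<Rightarrow> 'g extended"
  where
  "\<delta> wbar f = Max ((\<lambda>\<alpha>. wbar (to_fract [:-\<alpha>, 1:])) ` {\<alpha>. poly (map_poly to_ac f) \<alpha> = 0})"

definition abkp :: "('k::field alg_closure poly fract \<Rightarrow> 'g::linorder extended) \<Rightarrow> 'k poly \<Rightarrow> bool"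
  where
  "abkp wbar Q \<longleftrightarrow> monic Q \<and> degree Q > 0 \<and>
     (\<forall>f. 0 < degree f \<and> degree f < degree Q \<longrightarrow> \<delta> wbar f < \<delta> wbar Q)"

definition truncation ::
  "('k::field poly \<Rightarrow> 'g::linorder extended) \<Rightarrow> 'k poly \<Rightarrow> 'k poly \<Rightarrow> 'g extended" where
  "truncation u Q = expansion_min (\<lambda>i a. u (a * Q ^ i)) Q"

text \<open>
  In the last clause the polynomial \<open>Q\<^sub>i\<close> that computes \<open>w f\<close> is required to have degree at most
  \<open>degree f\<close> (for nonconstant \<open>f\<close>). Without this bound the clause says nothing about polynomials
  of degree smaller than that of some member of the family, because then \<open>w\<^sub>Q f = w f\<close> holds
  trivially: intermediate members of a family could be dropped at will, so that the degrees occurring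
  in it would not be determined by \<open>w\<close>, and truncations would not be related by augmentations. For
  example, over the rationals with the \<open>p\<close>-adic valuation, \<open>p\<close> an odd prime, take the valuation \<open>w\<close> given by \<open>w (X - 1) = 1/2\<close> and
  \<open>w ((X - 1)\<^sup>2 - p) = 3/2\<close>: the family consisting of \<open>X\<close> and \<open>(X - 1)\<^sup>2 - p\<close> would be complete,
  although the second member is not a key polynomial for the truncation at \<open>X\<close>.
\<close>

definition complete_abkp_set ::
  "('k::field poly \<Rightarrow> 'g::linorder extended) \<Rightarrow> ('k alg_closure poly fract \<Rightarrow> 'g extended) \<Rightarrow>
   'i set \<Rightarrow> ('i \<Rightarrow> 'k poly) \<Rightarrow> bool" where
  "complete_abkp_set u wbar \<Delta> Q \<longleftrightarrow>
     (\<forall>i\<in>\<Delta>. abkp wbar (Q i)) \<and>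
     (\<forall>i\<in>\<Delta>. \<forall>j\<in>\<Delta>. i \<noteq> j \<longrightarrow> \<delta> wbar (Q i) \<noteq> \<delta> wbar (Q j)) \<and>
     well_order_on (Q ` \<Delta>) {(p, q). p \<in> Q ` \<Delta> \<and> q \<in> Q ` \<Delta> \<and> \<delta> wbar p \<le> \<delta> wbar q} \<and>
     (\<forall>f. \<exists>i\<in>\<Delta>. truncation u (Q i) f = u f \<and> (degree f > 0 \<longrightarrow> degree (Q i) \<le> degree f))"

text \<open>
  \<open>\<Delta>\<close> is a subset of a linearly ordered type; \<open>num j\<close> is the natural number \<open>j\<close> viewed as an
  element of \<open>\<Delta>\<close>, and \<open>block num \<theta> j\<close> is \<open>\<Delta>\<^sub>j = {j} \<union> \<theta>\<^sub>j\<close>. An empty \<open>\<theta>\<^sub>j\<close> has no maximal element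
  either, so it is not listed as a separate case.
\<close>

definition block :: "(nat \<Rightarrow> 'i) \<Rightarrow> (nat \<Rightarrow> 'i set) \<Rightarrow> nat \<Rightarrow> 'i set" where
  "block num \<theta> j = insert (num j) (\<theta> j)"

definition indexed_complete_set ::
  "('k::field poly \<Rightarrow> 'g::linorder extended) \<Rightarrow> ('k alg_closure poly fract \<Rightarrow> 'g extended) \<Rightarrow>
   'i::linorder set \<Rightarrow> nat set \<Rightarrow> (nat \<Rightarrow> 'i) \<Rightarrow> (nat \<Rightarrow> 'i set) \<Rightarrow> ('i \<Rightarrow> 'k poly) \<Rightarrow> bool" where
  "indexed_complete_set u wbar \<Delta> I num \<theta> Q \<longleftrightarrow>
     complete_abkp_set u wbar \<Delta> Q \<and>
     ((\<exists>N. I = {..N}) \<or> I = UNIV) \<and> strict_mono_on I num \<and> \<Delta> = (\<Union>j\<in>I. block num \<theta> j) \<and>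
     (\<forall>j\<in>I. \<not> (\<exists>m\<in>\<theta> j. \<forall>i\<in>\<theta> j. i \<le> m)) \<and>
     Q (num 0) = [:0, 1:] \<and>
     (\<forall>j. Suc j \<in> I \<longrightarrow> (\<forall>i\<in>\<theta> j. num j < i \<and> i < num (Suc j))) \<and>
     (\<forall>j\<in>I. \<forall>i\<in>block num \<theta> j. \<forall>i'\<in>block num \<theta> j. degree (Q i) = degree (Q i')) \<and>
     (\<forall>j. Suc j \<in> I \<longrightarrow>
        (\<forall>i\<in>block num \<theta> j. \<forall>i'\<in>block num \<theta> (Suc j). degree (Q i) < degree (Q i'))) \<and>
     (\<forall>i\<in>\<Delta>. \<forall>i'\<in>\<Delta>. i < i' \<longrightarrow> u (Q i) < u (Q i') \<and> \<delta> wbar (Q i) < \<delta> wbar (Q i')) \<and>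
     ((\<exists>m\<in>\<Delta>. \<forall>i\<in>\<Delta>. i \<le> m) \<longleftrightarrow> (\<exists>N. I = {..N} \<and> \<theta> N = {}))"

text \<open>
  The second conjunct says that \<open>I\<close> (an initial segment of the naturals, hence known once its
  cardinality is) and the degrees of the \<open>Q\<^sub>j\<close> for \<open>j \<in> I\<close> are the same for all such families. It
  suffices to compare with families indexed by elements of \<^typ>\<open>'g extended\<close>: since \<open>i \<mapsto> \<delta> (Q\<^sub>i)\<close> is
  strictly increasing on \<open>\<Delta>\<close>, every family can be reindexed by the values \<open>\<delta> (Q\<^sub>i)\<close>.
\<close>

definition standard_complete_set ::
  "('k::field poly \<Rightarrow> 'g::linorder extended) \<Rightarrow> ('k alg_closure poly fract \<Rightarrow> 'g extended) \<Rightarrow>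
   'i::linorder set \<Rightarrow> nat set \<Rightarrow> (nat \<Rightarrow> 'i) \<Rightarrow> (nat \<Rightarrow> 'i set) \<Rightarrow> ('i \<Rightarrow> 'k poly) \<Rightarrow> bool" where
  "standard_complete_set u wbar \<Delta> I num \<theta> Q \<longleftrightarrow>
     indexed_complete_set u wbar \<Delta> I num \<theta> Q \<and>
     (\<forall>(\<Delta>' :: 'g extended set) I' num' \<theta>' Q'.
        indexed_complete_set u wbar \<Delta>' I' num' \<theta>' Q' \<longrightarrow>
        I' = I \<and> (\<forall>j\<in>I. degree (Q' (num' j)) = degree (Q (num j))))"

section \<open>Key polynomials\<close>

definition val_equiv :: "('k::field poly \<Rightarrow> 'g::linorder extended) \<Rightarrow> 'k poly \<Rightarrow> 'k poly \<Rightarrow> bool"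
  where
  "val_equiv u f g \<longleftrightarrow> u (f - g) > u f \<and> u f = u g"

definition val_dvd :: "('k::field poly \<Rightarrow> 'g::linorder extended) \<Rightarrow> 'k poly \<Rightarrow> 'k poly \<Rightarrow> bool"
  where
  "val_dvd u f g \<longleftrightarrow> (\<exists>h. val_equiv u g (f * h))"

text \<open>
  As usual, irreducible elements are nonunits: otherwise the constant polynomial \<open>1\<close> would be a key
  polynomial for every valuation.
\<close>

definition val_irreducible :: "('k::field poly \<Rightarrow> 'g::linorder extended) \<Rightarrow> 'k poly \<Rightarrow> bool" where
  "val_irreducible u f \<longleftrightarrow>
     \<not> val_dvd u f 1 \<and> (\<forall>h q. val_dvd u f (h * q) \<longrightarrow> val_dvd u f h \<or> val_dvd u f q)"

definition val_minimal :: "('k::field poly \<Rightarrow> 'g::linorder extended) \<Rightarrow> 'k poly \<Rightarrow> bool" where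
  "val_minimal u f \<longleftrightarrow> (\<forall>h. h \<noteq> 0 \<and> val_dvd u f h \<longrightarrow> degree f \<le> degree h)"

definition KP :: "('k::field poly \<Rightarrow> 'g::linorder extended) \<Rightarrow> 'k poly set" where
  "KP u = {f. monic f \<and> val_irreducible u f \<and> val_minimal u f}"

definition deg_val :: "('k::field poly \<Rightarrow> 'g::linorder extended) \<Rightarrow> nat" where
  "deg_val u = (LEAST d. \<exists>f\<in>KP u. degree f = d)"

definition deg_Phi ::
  "('k::field poly \<Rightarrow> 'g::linorder extended) \<Rightarrow> ('k poly \<Rightarrow> 'g extended) \<Rightarrow> nat" where
  "deg_Phi u u' = (LEAST d. \<exists>g. monic g \<and> u g < u' g \<and> degree g = d)"

definition Phi ::
  "('k::field poly \<Rightarrow> 'g::linorder extended) \<Rightarrow> ('k poly \<Rightarrow> 'g extended) \<Rightarrow> 'k poly set" where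
  "Phi u u' = {g. monic g \<and> u g < u' g \<and> degree g = deg_Phi u u'}"

section \<open>Augmentations\<close>

definition augment ::
  "('k::field poly \<Rightarrow> 'g::linordered_ab_group_add extended) \<Rightarrow> 'k poly \<Rightarrow> 'g extended \<Rightarrow>
   'k poly \<Rightarrow> 'g extended" where
  "augment u \<phi> \<gamma> = expansion_min (\<lambda>i a. u a + times_nat i \<gamma>) \<phi>"

definition ordinary_augmentation ::
  "('k::field poly \<Rightarrow> 'g::linordered_ab_group_add extended) \<Rightarrow> 'k poly \<Rightarrow> 'g extended \<Rightarrow>
   ('k poly \<Rightarrow> 'g extended) \<Rightarrow> bool" where
  "ordinary_augmentation u \<phi> \<gamma> u' \<longleftrightarrow>
     \<phi> \<in> KP u \<and> u \<phi> < \<gamma> \<and> \<gamma> \<noteq> Pinf \<and> u' = augment u \<phi> \<gamma>"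

text \<open>
  A family \<open>\<rho>\<^sub>i = [u; \<chi>\<^sub>i, \<gamma>\<^sub>i]\<close>, \<open>i \<in> A\<close>, is given by its index set, key polynomials and values.
\<close>

definition continuous_family ::
  "('k::field poly \<Rightarrow> 'g::linordered_ab_group_add extended) \<Rightarrow> 'i::linorder set \<Rightarrow>
   ('i \<Rightarrow> 'k poly) \<Rightarrow> ('i \<Rightarrow> 'g extended) \<Rightarrow> bool" where
  "continuous_family u A \<chi> \<gamma> \<longleftrightarrow>
     A \<noteq> {} \<and> \<not> (\<exists>m\<in>A. \<forall>i\<in>A. i \<le> m) \<and>
     (\<forall>i\<in>A. ordinary_augmentation u (\<chi> i) (\<gamma> i) (augment u (\<chi> i) (\<gamma> i))) \<and>
     (\<forall>i\<in>A. \<forall>j\<in>A. degree (\<chi> i) = degree (\<chi> j)) \<and>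
     (\<forall>i\<in>A. \<forall>j\<in>A. i < j \<longrightarrow>
        \<not> val_equiv (augment u (\<chi> i) (\<gamma> i)) (\<chi> j) (\<chi> i) \<and>
        ordinary_augmentation (augment u (\<chi> i) (\<gamma> i)) (\<chi> j) (\<gamma> j) (augment u (\<chi> j) (\<gamma> j)))"

definition has_stable_value ::
  "('i::linorder \<Rightarrow> 'k::field poly \<Rightarrow> 'g extended) \<Rightarrow> 'i set \<Rightarrow> 'k poly \<Rightarrow> 'g extended \<Rightarrow> bool" where
  "has_stable_value \<rho> A f c \<longleftrightarrow> (\<exists>i0\<in>A. \<forall>i\<in>A. i0 \<le> i \<longrightarrow> \<rho> i f = c)"

definition stable ::
  "('i::linorder \<Rightarrow> 'k::field poly \<Rightarrow> 'g extended) \<Rightarrow> 'i set \<Rightarrow> 'k poly \<Rightarrow> bool" where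
  "stable \<rho> A f \<longleftrightarrow> (\<exists>c. has_stable_value \<rho> A f c)"

definition stable_value ::
  "('i::linorder \<Rightarrow> 'k::field poly \<Rightarrow> 'g extended) \<Rightarrow> 'i set \<Rightarrow> 'k poly \<Rightarrow> 'g extended" where
  "stable_value \<rho> A f = (THE c. has_stable_value \<rho> A f c)"

text \<open>
  The number \<open>m\<^sub>\<infinity>\<close>. It is used only when unstable polynomials exist, which is what \<open>m\<^sub>\<infinity> < \<infinity>\<close> means.
\<close>

definition unstable_degree ::
  "('i::linorder \<Rightarrow> 'k::field poly \<Rightarrow> 'g extended) \<Rightarrow> 'i set \<Rightarrow> nat" where
  "unstable_degree \<rho> A = (LEAST d. \<exists>f. \<not> stable \<rho> A f \<and> degree f = d)"

definition essential_family ::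
  "('k::field poly \<Rightarrow> 'g::linordered_ab_group_add extended) \<Rightarrow> 'i::linorder set \<Rightarrow>
   ('i \<Rightarrow> 'k poly) \<Rightarrow> ('i \<Rightarrow> 'g extended) \<Rightarrow> bool" where
  "essential_family u A \<chi> \<gamma> \<longleftrightarrow>
     continuous_family u A \<chi> \<gamma> \<and>
     (\<exists>f. \<not> stable (\<lambda>i. augment u (\<chi> i) (\<gamma> i)) A f) \<and>
     (\<forall>i\<in>A. degree (\<chi> i) < unstable_degree (\<lambda>i. augment u (\<chi> i) (\<gamma> i)) A)"

definition KP_inf ::
  "('i::linorder \<Rightarrow> 'k::field poly \<Rightarrow> 'g extended) \<Rightarrow> 'i set \<Rightarrow> 'k poly set" where
  "KP_inf \<rho> A = {f. monic f \<and> \<not> stable \<rho> A f \<and> degree f = unstable_degree \<rho> A}"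

definition limit_augmentation ::
  "('k::field poly \<Rightarrow> 'g::linordered_ab_group_add extended) \<Rightarrow> 'i::linorder set \<Rightarrow>
   ('i \<Rightarrow> 'k poly) \<Rightarrow> ('i \<Rightarrow> 'g extended) \<Rightarrow> 'k poly \<Rightarrow> 'g extended \<Rightarrow>
   ('k poly \<Rightarrow> 'g extended) \<Rightarrow> bool" where
  "limit_augmentation u A \<chi> \<gamma> Q \<eta> u' \<longleftrightarrow>
     (let \<rho> = (\<lambda>i. augment u (\<chi> i) (\<gamma> i)) in
       essential_family u A \<chi> \<gamma> \<and> Q \<in> KP_inf \<rho> A \<and> (\<forall>i\<in>A. \<rho> i Q < \<eta>) \<and>
       u' = expansion_min (\<lambda>i a. stable_value \<rho> A a + times_nat i \<eta>) Q)"

section \<open>MacLane-Vaquie chains\<close>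

text \<open>
  A step carries the continuous family used in it, so that a chain need not quantify over index
  types.
\<close>

datatype ('i, 'p, 'g) mlv_step =
    Ordinary
  | Limit "'i set" "'i \<Rightarrow> 'p" "'i \<Rightarrow> 'g extended"

fun is_mlv_step ::
  "('i::linorder, 'k::field poly, 'g::linordered_ab_group_add) mlv_step \<Rightarrow>
   ('k poly \<Rightarrow> 'g extended) \<Rightarrow> 'k poly \<Rightarrow> 'k poly \<Rightarrow> 'g extended \<Rightarrow>
   ('k poly \<Rightarrow> 'g extended) \<Rightarrow> bool" where
  "is_mlv_step Ordinary u \<phi> \<phi>' \<gamma>' u' \<longleftrightarrow>
     ordinary_augmentation u \<phi>' \<gamma>' u' \<and> deg_val u < deg_Phi u u'"
| "is_mlv_step (Limit A \<chi> \<beta>) u \<phi> \<phi>' \<gamma>' u' \<longleftrightarrow>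
     limit_augmentation u A \<chi> \<beta> \<phi>' \<gamma>' u' \<and> deg_val u = deg_Phi u u' \<and> \<phi> \<notin> Phi u u'"

text \<open>A finite chain \<open>W\<^sub>0 \<rightarrow> \<dots> \<rightarrow> W\<^sub>N\<close>; step \<open>n\<close> leads from \<open>W\<^sub>n\<close> to \<open>W\<^sub>n\<^sub>+\<^sub>1\<close>.\<close>

definition finite_mlv_chain ::
  "nat \<Rightarrow> (nat \<Rightarrow> 'k::field poly \<Rightarrow> 'g::linordered_ab_group_add extended) \<Rightarrow>
   (nat \<Rightarrow> 'k poly) \<Rightarrow> (nat \<Rightarrow> 'g extended) \<Rightarrow>
   (nat \<Rightarrow> ('i::linorder, 'k poly, 'g) mlv_step) \<Rightarrow> bool" where
  "finite_mlv_chain N W \<phi> \<gamma> S \<longleftrightarrow>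
     (\<forall>n\<le>N. valuation (W n)) \<and>
     \<phi> 0 \<in> KP (W 0) \<and> degree (\<phi> 0) = deg_val (W 0) \<and> \<gamma> 0 = W 0 (\<phi> 0) \<and>
     (\<forall>n<N. is_mlv_step (S n) (W n) (\<phi> n) (\<phi> (Suc n)) (\<gamma> (Suc n)) (W (Suc n)))"

definition depth_zero ::
  "('k::field \<Rightarrow> 'g::linordered_ab_group_add extended) \<Rightarrow> ('k poly \<Rightarrow> 'g extended) \<Rightarrow> bool" where
  "depth_zero v u \<longleftrightarrow>
     (\<exists>a \<gamma>. \<gamma> \<noteq> Minf \<and>
        (\<forall>n c. u (\<Sum>i\<le>n. smult (c i) ([:-a, 1:] ^ i)) =
               Min ((\<lambda>i. v (c i) + times_nat i \<gamma>) ` {..n})))"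

definition complete_finite_mlv_chain ::
  "('k::field \<Rightarrow> 'g::linordered_ab_group_add extended) \<Rightarrow>
   nat \<Rightarrow> (nat \<Rightarrow> 'k poly \<Rightarrow> 'g extended) \<Rightarrow> (nat \<Rightarrow> 'k poly) \<Rightarrow> (nat \<Rightarrow> 'g extended) \<Rightarrow>
   (nat \<Rightarrow> ('i::linorder, 'k poly, 'g) mlv_step) \<Rightarrow> bool" where
  "complete_finite_mlv_chain v N W \<phi> \<gamma> S \<longleftrightarrow>
     finite_mlv_chain N W \<phi> \<gamma> S \<and> depth_zero v (W 0)"

end

theory Submission
  imports Defs
begin

text \<open>
  Everything rests on a description of the truncations over the algebraic closure. Let \<open>Q\<close> be an
  abstract key polynomial and \<open>\<alpha>\<close> a root of \<open>Q\<close> at which \<open>wbar (X - \<alpha>)\<close> takes its maximum \<open>\<delta> Q\<close>. Then the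
  truncation at \<open>Q\<close> is the restriction to \<open>K[X]\<close> of the Gauss valuation in powers of \<open>X - \<alpha>\<close> that
  gives \<open>X - \<alpha>\<close> the value \<open>\<delta> Q\<close> (\<open>truncation_eq_disc_val\<close>). The reason is that a polynomial of degree below
  \<open>degree Q\<close> has all its roots outside this disc, so on the disc it is the constant \<open>f \<alpha>\<close> up to larger
  value, whereas \<open>Q\<close> vanishes at \<open>\<alpha>\<close>. Hence the terms of a \<open>Q\<close>-expansion cannot cancel.

  The Gauss valuation of \<open>X - \<beta>\<close> is the minimum of \<open>\<delta> Q\<close> and \<open>wbar (X - \<beta>)\<close>. Factoring \<open>f\<close> into linear
  factors therefore shows how truncations compare: they increase with \<open>\<delta> Q\<close>; the truncation
  at \<open>Q\<close> is smaller than \<open>w\<close> at every \<open>Q'\<close> with larger \<open>\<delta>\<close>; and two truncations with different \<open>\<delta>\<close> agree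
  at \<open>f\<close> only if both already give \<open>w f\<close>.

  Key polynomials come from MacLane's criterion (\<open>least_degree_less_imp_KP\<close>): a monic polynomial of least
  degree at which a larger valuation exceeds \<open>u\<close> is a key polynomial for \<open>u\<close>. With \<open>w\<close> as the larger
  valuation it yields the augmenting polynomials. With evaluation at \<open>\<alpha>\<close>, which is infinite at \<open>Q\<close>, it shows that \<open>Q\<close> is
  a key polynomial for its own truncation.

  Finally, completeness of the set says that below the degree of \<open>Q\<^sub>j\<^sub>+\<^sub>1\<close> the valuation \<open>w\<close> is computed by
  the truncations in the blocks up to \<open>\<Delta>\<^sub>j\<close>. If \<open>\<theta>\<^sub>j\<close> is empty, the truncation at \<open>Q\<^sub>j\<close> itself agrees with \<open>w\<close>
  there, and \<open>Q\<^sub>j\<^sub>+\<^sub>1\<close> is a polynomial of least degree where it does not: this is an ordinary step. If \<open>\<theta>\<^sub>j\<close> is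
  nonempty, the truncations along \<open>\<theta>\<^sub>j\<close> form a continuous family that stabilises at \<open>w\<close> below that degree
  and keeps increasing at \<open>Q\<^sub>j\<^sub>+\<^sub>1\<close>: this is a limit step. The truncation at the last member is \<open>w\<close>.
\<close>

section \<open>Values and valuations\<close>

lemma extended_add_strict_mono:
  fixes a b c d :: "'g::linordered_ab_group_add extended"
  assumes "a < b" "c \<le> d" "a \<noteq> Minf" "c \<noteq> Minf" "c \<noteq> Pinf"
  shows "a + c < b + d"
  using assms by (cases a; cases b; cases c; cases d) (auto intro: add_less_le_mono)

lemma extended_add_eq_imp_eq:
  fixes a b c d :: "'g::linordered_ab_group_add extended"
  assumes "a + c = b + d" "a \<le> b" "c \<le> d" "a + c \<noteq> Pinf" "a \<noteq> Minf" "c \<noteq> Minf"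
  shows "a = b \<and> c = d"
proof -
  have "a \<noteq> Pinf" "c \<noteq> Pinf"
    using assms(4-6) by (cases a; cases c; simp)+
  with assms show ?thesis
    using extended_add_strict_mono[of a b c d] extended_add_strict_mono[of c d a b]
    by (auto simp: add.commute order.order_iff_strict)
qed

lemma times_nat_0 [simp]: "times_nat 0 \<gamma> = 0"
  by (simp add: times_nat_def)

lemma times_nat_Suc: "times_nat (Suc n) \<gamma> = \<gamma> + times_nat n \<gamma>"
  by (simp add: times_nat_def add.commute)

lemma times_nat_add: "times_nat (m + n) \<gamma> = times_nat m \<gamma> + times_nat n \<gamma>"
  by (induction m) (simp_all add: times_nat_Suc add.assoc)

lemma times_nat_Fin: "\<exists>h. times_nat n (Fin g) = Fin h"
  by (induction n) (auto simp: times_nat_Suc zero_extended_def)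

lemma times_nat_not_Minf: "\<gamma> \<noteq> Minf \<Longrightarrow> times_nat n \<gamma> \<noteq> Minf"
proof (induction n)
  case (Suc n)
  then show ?case
    by (cases \<gamma>; cases "times_nat n \<gamma>") (auto simp: times_nat_Suc)
qed (simp add: zero_extended_def)

lemma valuation_not_Minf: "valuation u \<Longrightarrow> u x \<noteq> Minf"
  and valuation_zero: "valuation u \<Longrightarrow> u 0 = Pinf"
  and valuation_one: "valuation u \<Longrightarrow> u 1 = 0"
  and valuation_mult: "valuation u \<Longrightarrow> u (x * y) = u x + u y"
  and valuation_add: "valuation u \<Longrightarrow> min (u x) (u y) \<le> u (x + y)"
  by (auto simp: valuation_def)

lemma valuation_uminus:
  assumes "valuation u"
  shows "u (- x) = u x"
proof -
  have "u (- 1) + u (- 1) = 0"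
    using valuation_mult[OF assms, of "-1" "-1"] valuation_one[OF assms] by simp
  then have "u (- 1) = 0"
    by (cases "u (- 1)") (auto simp: zero_extended_def)
  then show ?thesis
    using valuation_mult[OF assms, of "-1" x] by simp
qed

lemma valuation_diff:
  assumes "valuation u"
  shows "min (u x) (u y) \<le> u (x - y)"
  using valuation_add[OF assms, of x "- y"] valuation_uminus[OF assms] by simp

lemma valuation_diff_commute: "valuation u \<Longrightarrow> u (x - y) = u (y - x)"
  using valuation_uminus[of u "x - y"] by simp

lemma valuation_add_eq:
  assumes "valuation u" "u x < u y"
  shows "u (x + y) = u x"
proof (rule antisym)
  show "u x \<le> u (x + y)"
    using valuation_add[OF assms(1), of x y] assms(2) by (simp add: min.absorb1 less_imp_le)
  show "u (x + y) \<le> u x"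
    using valuation_diff[OF assms(1), of "x + y" y] assms(2) by (auto simp: min_def split: if_splits)
qed

lemma valuation_diff_gt_imp_eq:
  assumes "valuation u" "u x < u (x - y)"
  shows "u y = u x"
proof -
  have "u (x + (y - x)) = u x"
    using assms valuation_diff_commute[OF assms(1), of x y] by (intro valuation_add_eq) auto
  then show ?thesis by simp
qed

lemma valuation_field_finite:
  fixes x :: "'a::field"
  assumes "valuation z" "x \<noteq> 0"
  shows "z x \<noteq> Pinf"
proof
  assume "z x = Pinf"
  then have "z (x * inverse x) = Pinf"
    using valuation_not_Minf[OF assms(1), of "inverse x"]
    by (cases "z (inverse x)") (auto simp: valuation_mult[OF assms(1)])
  then show False using assms by (simp add: valuation_one zero_extended_def)
qed

lemma valuation_power: "valuation u \<Longrightarrow> u (x ^ n) = times_nat n (u x)"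
  by (induction n) (auto simp: valuation_one valuation_mult times_nat_Suc)

lemma valuation_sum_ge:
  assumes "valuation u" "\<And>s. s \<in> S \<Longrightarrow> c \<le> u (h s)"
  shows "c \<le> u (sum h S)"
  using assms(2)
proof (induction S rule: infinite_finite_induct)
  case (insert s S)
  then have "c \<le> min (u (h s)) (u (sum h S))" by auto
  also have "\<dots> \<le> u (h s + sum h S)" by (rule valuation_add[OF assms(1)])
  finally show ?case using insert by simp
qed (auto simp: valuation_zero[OF assms(1)])

lemma valuation_sum_gt:
  assumes "valuation u" "\<And>s. s \<in> S \<Longrightarrow> c < u (h s)" "c < Pinf"
  shows "c < u (sum h S)"
  using assms(2)
proof (induction S rule: infinite_finite_induct)
  case (insert s S)
  then have "c < min (u (h s)) (u (sum h S))" by auto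
  also have "\<dots> \<le> u (h s + sum h S)" by (rule valuation_add[OF assms(1)])
  finally show ?case using insert by simp
qed (auto simp: valuation_zero[OF assms(1)] assms(3))

lemma valuation_comp:
  assumes "valuation u" "h 0 = 0" "h 1 = 1"
    and "\<And>x y. h (x + y) = h x + h y" "\<And>x y. h (x * y) = h x * h y"
  shows "valuation (\<lambda>x. u (h x))"
  using assms by (simp add: valuation_def)

section \<open>Gauss valuations\<close>

definition gauss_val ::
  "('k::field \<Rightarrow> 'g::linordered_ab_group_add extended) \<Rightarrow> 'g extended \<Rightarrow> 'k poly \<Rightarrow> 'g extended"
  where
  "gauss_val v \<gamma> f = Min ((\<lambda>i. v (coeff f i) + times_nat i \<gamma>) ` {..degree f})"

lemma gauss_val_le_coeff:
  assumes "valuation v" "\<gamma> \<noteq> Minf"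
  shows "gauss_val v \<gamma> f \<le> v (coeff f i) + times_nat i \<gamma>"
proof (cases "i \<le> degree f")
  case True
  then show ?thesis unfolding gauss_val_def by (intro Min_le) auto
next
  case False
  then have "v (coeff f i) = Pinf"
    by (simp add: coeff_eq_0 valuation_zero[OF assms(1)])
  then show ?thesis
    by (cases "times_nat i \<gamma>") auto
qed

lemma le_gauss_val_iff:
  assumes "valuation v" "\<gamma> \<noteq> Minf"
  shows "c \<le> gauss_val v \<gamma> f \<longleftrightarrow> (\<forall>i. c \<le> v (coeff f i) + times_nat i \<gamma>)"
proof
  show "c \<le> gauss_val v \<gamma> f \<Longrightarrow> \<forall>i. c \<le> v (coeff f i) + times_nat i \<gamma>"
    using gauss_val_le_coeff[OF assms, of f] by (meson order_trans)
qed (auto simp: gauss_val_def)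

lemma gauss_val_attained: "\<exists>i. v (coeff f i) + times_nat i \<gamma> = gauss_val v \<gamma> f"
proof -
  have "gauss_val v \<gamma> f \<in> (\<lambda>i. v (coeff f i) + times_nat i \<gamma>) ` {..degree f}"
    unfolding gauss_val_def by (intro Min_in) auto
  then show ?thesis by auto
qed

lemma gauss_val_mult_ge:
  assumes v: "valuation v" and \<gamma>: "\<gamma> \<noteq> Minf"
  shows "gauss_val v \<gamma> f + gauss_val v \<gamma> g \<le> gauss_val v \<gamma> (f * g)"
proof -
  have "gauss_val v \<gamma> f + gauss_val v \<gamma> g \<le> v (coeff (f * g) n) + times_nat n \<gamma>" for n
  proof -
    obtain s where s: "s \<le> n" "v (coeff f s * coeff g (n - s)) \<le> v (coeff (f * g) n)"
    proof -
      let ?V = "(\<lambda>s. v (coeff f s * coeff g (n - s))) ` {..n}"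
      have "Min ?V \<le> v (coeff (f * g) n)"
        unfolding coeff_mult by (intro valuation_sum_ge[OF v]) auto
      moreover have "Min ?V \<in> ?V" by (intro Min_in) auto
      ultimately obtain s where "s \<le> n" "Min ?V = v (coeff f s * coeff g (n - s))"
        by (metis (no_types, lifting) atMost_iff imageE)
      with \<open>Min ?V \<le> v (coeff (f * g) n)\<close> show ?thesis by (intro that[of s]) auto
    qed
    have "gauss_val v \<gamma> f + gauss_val v \<gamma> g \<le>
        (v (coeff f s) + times_nat s \<gamma>) + (v (coeff g (n - s)) + times_nat (n - s) \<gamma>)"
      by (intro add_mono gauss_val_le_coeff v \<gamma>)
    also have "\<dots> = v (coeff f s * coeff g (n - s)) + times_nat n \<gamma>"
      using s(1) times_nat_add[of s "n - s" \<gamma>] by (simp add: valuation_mult[OF v] ac_simps)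
    also have "\<dots> \<le> v (coeff (f * g) n) + times_nat n \<gamma>"
      using s(2) by (rule add_right_mono)
    finally show ?thesis .
  qed
  then show ?thesis by (simp add: le_gauss_val_iff[OF v \<gamma>])
qed

text \<open>
  The Gauss lemma: at the least indices \<open>i\<close> and \<open>j\<close> where the minima for \<open>f\<close> and \<open>g\<close> are attained,
  the term \<open>f\<^sub>i g\<^sub>j\<close> of the coefficient of index \<open>i + j\<close> of the product is strictly dominant, since
  every other term has a factor of smaller index.
\<close>

lemma gauss_val_mult_le:
  assumes v: "valuation v"
  shows "gauss_val v (Fin h) (f * g) \<le> gauss_val v (Fin h) f + gauss_val v (Fin h) g"
proof -
  let ?G = "gauss_val v (Fin h)"
  let ?t = "\<lambda>n. times_nat n (Fin h)"
  have le: "?G p \<le> v (coeff p i) + ?t i" for p i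
    by (rule gauss_val_le_coeff[OF v]) simp
  have not_Minf: "?G p \<noteq> Minf" for p
  proof -
    obtain i where "v (coeff p i) + ?t i = ?G p" using gauss_val_attained by blast
    then show ?thesis
      using valuation_not_Minf[OF v, of "coeff p i"] times_nat_not_Minf[of "Fin h" i]
      by (cases "v (coeff p i)"; cases "?t i") auto
  qed
  show ?thesis
  proof (cases "?G f = Pinf \<or> ?G g = Pinf")
    case True
    then have "?G f + ?G g = Pinf"
      using not_Minf[of f] not_Minf[of g] by (cases "?G f"; cases "?G g") auto
    then show ?thesis by simp
  next
    case False
    define i where "i = (LEAST i. v (coeff f i) + ?t i = ?G f)"
    define j where "j = (LEAST j. v (coeff g j) + ?t j = ?G g)"
    have i: "v (coeff f i) + ?t i = ?G f"
      unfolding i_def by (rule LeastI_ex) (rule gauss_val_attained)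
    have j: "v (coeff g j) + ?t j = ?G g"
      unfolding j_def by (rule LeastI_ex) (rule gauss_val_attained)
    have less_i: "?G f < v (coeff f s) + ?t s" if "s < i" for s
      using not_less_Least[OF that[unfolded i_def]] le[of f s] by (auto simp: less_le)
    have less_j: "?G g < v (coeff g s) + ?t s" if "s < j" for s
      using not_less_Least[OF that[unfolded j_def]] le[of g s] by (auto simp: less_le)
    define n where "n = i + j"
    obtain tn where tn: "?t n = Fin tn" using times_nat_Fin by blast
    have split_n: "v (coeff f s * coeff g (n - s)) + ?t n =
        (v (coeff f s) + ?t s) + (v (coeff g (n - s)) + ?t (n - s))" if "s \<le> n" for s
      using that times_nat_add[of s "n - s" "Fin h"] by (simp add: valuation_mult[OF v] ac_simps)
    have main: "v (coeff f i * coeff g j) + ?t n = ?G f + ?G g"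
      using split_n[of i] i j by (simp add: n_def)
    have "v (coeff f i * coeff g j) < v (coeff f s * coeff g (n - s))" if "s \<in> {..n} - {i}" for s
    proof -
      have "?G f + ?G g < v (coeff f s * coeff g (n - s)) + ?t n"
      proof (cases "s < i")
        case True
        then show ?thesis
          using that False not_Minf split_n[of s] extended_add_strict_mono[OF less_i le] by auto
      next
        case s: False
        then have "n - s < j" using that by (auto simp: n_def)
        then show ?thesis
          using that False not_Minf split_n[of s] extended_add_strict_mono[OF less_j le[of f s], of "n - s"]
          by (auto simp: add.commute)
      qed
      then show ?thesis
        using main tn
        by (metis add_right_mono not_less)
    qed
    moreover have "v (coeff f i * coeff g j) < Pinf"
      using main tn False not_Minf[of f] not_Minf[of g]
      by (cases "v (coeff f i * coeff g j)"; cases "?G f"; cases "?G g") auto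
    ultimately have "v (coeff f i * coeff g j) <
        v (\<Sum>s\<in>{..n} - {i}. coeff f s * coeff g (n - s))"
      by (intro valuation_sum_gt[OF v]) auto
    moreover have "coeff (f * g) n =
        coeff f i * coeff g j + (\<Sum>s\<in>{..n} - {i}. coeff f s * coeff g (n - s))"
      unfolding coeff_mult by (subst sum.remove[of _ i]) (auto simp: n_def)
    ultimately have "v (coeff (f * g) n) = v (coeff f i * coeff g j)"
      using valuation_add_eq[OF v] by auto
    then show ?thesis
      using le[of "f * g" n] main by simp
  qed
qed

lemma valuation_gauss_val:
  assumes v: "valuation v" and \<gamma>: "\<gamma> \<noteq> Minf" "\<gamma> \<noteq> Pinf"
  shows "valuation (gauss_val v \<gamma>)"
proof -
  obtain h where h: "\<gamma> = Fin h" using \<gamma> by (cases \<gamma>) auto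
  have "min (gauss_val v \<gamma> f) (gauss_val v \<gamma> g) \<le> gauss_val v \<gamma> (f + g)" for f g
  proof -
    have "min (gauss_val v \<gamma> f) (gauss_val v \<gamma> g) \<le> v (coeff f i + coeff g i) + times_nat i \<gamma>" for i
    proof -
      have "min (gauss_val v \<gamma> f) (gauss_val v \<gamma> g) \<le>
          min (v (coeff f i) + times_nat i \<gamma>) (v (coeff g i) + times_nat i \<gamma>)"
        by (intro min.mono gauss_val_le_coeff v \<gamma>)
      also have "\<dots> \<le> min (v (coeff f i)) (v (coeff g i)) + times_nat i \<gamma>"
        by (cases "v (coeff f i) \<le> v (coeff g i)") (simp_all add: min.absorb1 min.absorb2 min.coboundedI1)
      also have "\<dots> \<le> v (coeff f i + coeff g i) + times_nat i \<gamma>"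
        by (intro add_right_mono valuation_add[OF v])
      finally show ?thesis .
    qed
    then show ?thesis by (simp add: le_gauss_val_iff[OF v \<gamma>(1)])
  qed
  moreover have "gauss_val v \<gamma> (f * g) = gauss_val v \<gamma> f + gauss_val v \<gamma> g" for f g
    using gauss_val_mult_le[OF v, of h f g] gauss_val_mult_ge[OF v \<gamma>(1), of f g] h by auto
  moreover have "gauss_val v \<gamma> f \<noteq> Minf" for f
  proof -
    obtain i where "v (coeff f i) + times_nat i \<gamma> = gauss_val v \<gamma> f" using gauss_val_attained by blast
    then show ?thesis
      using valuation_not_Minf[OF v, of "coeff f i"] times_nat_not_Minf[OF \<gamma>(1), of i]
      by (cases "v (coeff f i)"; cases "times_nat i \<gamma>") auto
  qed
  ultimately show ?thesis
    by (simp add: valuation_def gauss_val_def valuation_zero[OF v] valuation_one[OF v])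
qed

section \<open>Key polynomials from comparison of valuations\<close>

lemma monic_degree_0:
  assumes "monic f" "degree f = 0"
  shows "f = 1"
proof -
  obtain a where "f = [:a:]" using assms(2) by (rule degree_eq_zeroE)
  then show ?thesis using assms(1) by (simp add: monic_def)
qed

text \<open>
  Write \<open>f = \<phi> q + r\<close>. If \<open>u f < u' f\<close> and \<open>r\<close> had value at most \<open>u f\<close>, then \<open>\<phi> q\<close> and \<open>r\<close> would have the same
  value for \<open>u'\<close>, hence \<open>\<phi> q\<close> would be smaller than \<open>r\<close> for \<open>u\<close>, and so would \<open>f\<close>. Thus
  \<open>r\<close> is negligible.
\<close>

lemma val_dvd_iff_less:
  fixes u u' :: "'k::field poly \<Rightarrow> 'g::linordered_ab_group_add extended"
  assumes u: "valuation u" and u': "valuation u'" and le: "\<And>f. u f \<le> u' f"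
    and less: "u \<phi> < u' \<phi>" and low: "\<And>f. degree f < degree \<phi> \<Longrightarrow> u f = u' f"
    and deg: "degree \<phi> > 0"
  shows "val_dvd u \<phi> f \<longleftrightarrow> u f < u' f"
proof
  have less_mult: "u (\<phi> * h) < u' (\<phi> * h)" if "u (\<phi> * h) \<noteq> Pinf" for h
  proof -
    have "u h \<noteq> Pinf"
      using that valuation_not_Minf[OF u, of \<phi>] by (cases "u \<phi>") (auto simp: valuation_mult[OF u])
    then show ?thesis
      using extended_add_strict_mono[OF less le[of h]] valuation_not_Minf[OF u]
      by (simp add: valuation_mult[OF u] valuation_mult[OF u'])
  qed
  {
    assume "val_dvd u \<phi> f"
    then obtain h where h: "u f < u (f - \<phi> * h)" "u f = u (\<phi> * h)"
      by (auto simp: val_dvd_def val_equiv_def)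
    have "u f < u' (\<phi> * h)"
      using h less_mult[of h] by (metis less_extended_simps(4))
    with h le[of "f - \<phi> * h"] have "u f < min (u' (f - \<phi> * h)) (u' (\<phi> * h))" by auto
    also have "\<dots> \<le> u' f"
      using valuation_add[OF u', of "f - \<phi> * h" "\<phi> * h"] by simp
    finally show "u f < u' f" .
  }
  assume f: "u f < u' f"
  define q r where "q = f div \<phi>" and "r = f mod \<phi>"
  have f_eq: "f = \<phi> * q + r" by (simp add: q_def r_def)
  have r: "u r = u' r"
    using deg by (intro low) (cases "r = 0"; auto simp: r_def intro!: degree_mod_less')
  have "u f < u r"
  proof (rule ccontr)
    assume "\<not> u f < u r"
    then have ur: "u r \<le> u f" "u' r < u' f" using f r by auto
    then have "u' (\<phi> * q) = u' r"
      using valuation_add_eq[OF u', of "- r" f] by (simp add: valuation_uminus[OF u'] f_eq)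
    moreover from this have "u (\<phi> * q) \<noteq> Pinf"
      using le[of "\<phi> * q"] ur(2) by auto
    ultimately have "u (\<phi> * q) < u r" using less_mult[of q] r by auto
    then have "u f = u (\<phi> * q)" unfolding f_eq by (rule valuation_add_eq[OF u])
    with \<open>u (\<phi> * q) < u r\<close> ur(1) show False by auto
  qed
  moreover have "f - \<phi> * q = r" by (simp add: f_eq)
  ultimately have "val_equiv u f (\<phi> * q)"
    using valuation_diff_gt_imp_eq[OF u, of f "\<phi> * q"] by (simp add: val_equiv_def)
  then show "val_dvd u \<phi> f" by (auto simp: val_dvd_def)
qed

text \<open>
  MacLane's criterion. For \<open>u \<le> u'\<close> and \<open>\<phi>\<close> monic of least degree with \<open>u \<phi> < u' \<phi>\<close>, the multiples of
  \<open>\<phi>\<close> with respect to \<open>u\<close> are the \<open>f\<close> with \<open>u f < u' f\<close>. Minimality is then the choice of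
  \<open>\<phi>\<close>, and irreducibility is the multiplicativity of both valuations. The valuation \<open>u'\<close> may have a
  nontrivial support.
\<close>

lemma least_degree_less_imp_KP:
  fixes u u' :: "'k::field poly \<Rightarrow> 'g::linordered_ab_group_add extended"
  assumes u: "valuation u" and u': "valuation u'" and le: "\<And>f. u f \<le> u' f"
    and less: "u \<phi> < u' \<phi>" and low: "\<And>f. degree f < degree \<phi> \<Longrightarrow> u f = u' f"
    and monic: "monic \<phi>"
  shows "\<phi> \<in> KP u"
proof -
  have "\<phi> \<noteq> 1" using less by (auto simp: valuation_one[OF u] valuation_one[OF u'])
  then have deg: "degree \<phi> > 0"
    using monic monic_degree_0 by blast
  have dvd: "val_dvd u \<phi> f \<longleftrightarrow> u f < u' f" for f
    using val_dvd_iff_less[OF u u' le less] low deg by blast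
  have "u h < u' h \<or> u q < u' q" if "u (h * q) < u' (h * q)" for h q
    using that le[of h] le[of q]
    by (auto simp: valuation_mult[OF u] valuation_mult[OF u'] order.order_iff_strict)
  then have "val_irreducible u \<phi>"
    unfolding val_irreducible_def dvd by (simp add: valuation_one[OF u] valuation_one[OF u'])
  moreover have "val_minimal u \<phi>"
    unfolding val_minimal_def dvd using low by (metis less_irrefl not_le_imp_less)
  ultimately show ?thesis using monic by (simp add: KP_def)
qed

lemma KP_degree_pos:
  assumes "valuation u" "f \<in> KP u"
  shows "degree f > 0"
proof (rule ccontr)
  assume "\<not> degree f > 0"
  then have "f = 1" using assms(2) monic_degree_0 by (auto simp: KP_def)
  moreover have "val_equiv u 1 (1 * 1)"
    using assms(1) by (simp add: val_equiv_def valuation_def zero_extended_def)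
  ultimately show False
    using assms(2) unfolding KP_def val_irreducible_def val_dvd_def by blast
qed

text \<open>
  If the remainder of \<open>Q\<close> modulo \<open>f\<close> has smaller value than \<open>Q\<close>, it is divisible by \<open>f\<close> up to larger
  value, which a key polynomial \<open>f\<close> excludes by minimality.
\<close>

lemma KP_degree_ge:
  assumes u: "valuation u" and f: "f \<in> KP u"
    and low: "\<And>f. 0 < degree f \<Longrightarrow> degree f < degree Q \<Longrightarrow> u (Q mod f) < u Q"
  shows "degree Q \<le> degree f"
proof (rule ccontr)
  assume "\<not> degree Q \<le> degree f"
  then have less: "u (Q mod f) < u Q" and pos: "degree f > 0"
    using low KP_degree_pos[OF u f] by auto
  have ne: "Q mod f \<noteq> 0" using less by (auto simp: valuation_zero[OF u])
  have "Q mod f - f * (- (Q div f)) = Q" by simp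
  then have "val_equiv u (Q mod f) (f * (- (Q div f)))"
    using less valuation_diff_gt_imp_eq[OF u, of "Q mod f" "f * (- (Q div f))"]
    unfolding val_equiv_def by metis
  then have "val_dvd u f (Q mod f)" unfolding val_dvd_def by blast
  then have "degree f \<le> degree (Q mod f)"
    using f ne by (auto simp: KP_def val_minimal_def)
  moreover have "degree (Q mod f) < degree f"
    using ne pos by (intro degree_mod_less') auto
  ultimately show False by simp
qed

section \<open>Truncations\<close>

text \<open>
  The model for \<open>P\<close> is \<open>f \<mapsto> v (f \<alpha>)\<close> for a root \<open>\<alpha>\<close> of \<open>Q\<close>. It singles out the constant term of a
  \<open>Q\<close>-expansion, so that \<open>M h\<^sub>0 = P h\<^sub>0 = P h \<ge> M h\<close> for \<open>h = h\<^sub>0 + Q h'\<close>. Hence no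
  cancellation can occur in a \<open>Q\<close>-expansion.
\<close>

lemma truncation_eqI:
  fixes u M P :: "'k::field poly \<Rightarrow> 'g::linordered_ab_group_add extended"
  assumes u: "valuation u" and M: "valuation M" and P: "valuation P"
    and le: "\<And>f. M f \<le> P f" and PQ: "P Q = Pinf" and deg: "degree Q > 0"
    and MP: "\<And>a. degree a < degree Q \<Longrightarrow> M a = P a"
    and Mu: "\<And>a. degree a < degree Q \<Longrightarrow> M a = u a" and MQ: "M Q = u Q"
  shows "truncation u Q = M"
proof
  fix f
  have monomial: "M (expansion_coeff Q f i * Q ^ i) = u (expansion_coeff Q f i * Q ^ i)" for i
    using Mu[OF expansion_coeff_degree[OF deg, of f i]] MQ
    by (simp add: valuation_mult[OF M] valuation_mult[OF u] valuation_power[OF M] valuation_power[OF u])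
  have constant_term: "M h \<le> M (h mod Q)" for h
  proof -
    have PhQ: "P (h div Q * Q) = Pinf"
      using PQ valuation_not_Minf[OF P, of "h div Q"]
      by (cases "P (h div Q)") (auto simp: valuation_mult[OF P])
    have "P (h mod Q) \<ge> P h"
      using valuation_diff[OF P, of h "h div Q * Q"] PhQ by (simp add: minus_div_mult_eq_mod)
    moreover have "M (h mod Q) = P (h mod Q)"
      using deg by (intro MP) (cases "h mod Q = 0"; auto intro!: degree_mod_less')
    ultimately show ?thesis using le[of h] by simp
  qed
  have tail: "M f \<le> M (f div Q ^ i * Q ^ i)" for i
  proof (induction i)
    case (Suc i)
    define h where "h = f div Q ^ i"
    have "M h \<le> min (M h) (M (h mod Q))" using constant_term[of h] by simp
    also have "\<dots> \<le> M (h div Q * Q)"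
      using valuation_diff[OF M, of h "h mod Q"] by (simp add: minus_mod_eq_div_mult)
    finally have "M (h * Q ^ i) \<le> M (h div Q * Q * Q ^ i)"
      unfolding valuation_mult[OF M] by (intro add_right_mono)
    moreover have "f div Q ^ Suc i = h div Q"
      using poly_div_mult_right[of f "Q ^ i" Q] by (simp add: h_def mult.commute)
    ultimately show ?case using Suc by (simp add: h_def mult.assoc)
  qed simp
  have "M f \<le> M (expansion_coeff Q f i * Q ^ i)" for i
    using tail[of i] add_right_mono[OF constant_term[of "f div Q ^ i"], of "M (Q ^ i)"]
    by (simp add: expansion_coeff_def valuation_mult[OF M])
  then have "M f \<le> truncation u Q f"
    unfolding truncation_def expansion_min_def by (auto simp: monomial)
  moreover have "truncation u Q f \<le> M (\<Sum>i\<le>degree f. expansion_coeff Q f i * Q ^ i)"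
  proof (rule valuation_sum_ge[OF M])
    show "truncation u Q f \<le> M (expansion_coeff Q f s * Q ^ s)" if "s \<in> {..degree f}" for s
      unfolding truncation_def expansion_min_def using that by (subst Min_le_iff) (auto simp: monomial)
  qed
  ultimately show "truncation u Q f = M f"
    using expansion_coeff_sum[OF deg, of f] by simp
qed

lemma expansion_min_eq_truncation:
  assumes u: "valuation u" and deg: "degree Q > 0"
    and h: "\<And>a. degree a < degree Q \<Longrightarrow> h a = u a"
  shows "expansion_min (\<lambda>i a. h a + times_nat i (u Q)) Q = truncation u Q"
  unfolding truncation_def expansion_min_def
  by (simp add: h[OF expansion_coeff_degree[OF deg]] valuation_mult[OF u] valuation_power[OF u])

lemma truncation_low_degree:
  assumes u: "valuation u" and deg: "degree f < degree Q"
  shows "truncation u Q f = u f"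
proof -
  have "expansion_coeff Q f i = (if i = 0 then f else 0)" for i
  proof (cases i)
    case (Suc n)
    have "degree f < degree (Q ^ i)"
      using deg Suc by (metis degree_power_eq degree_0 mult_Suc not_less_zero trans_less_add1)
    then show ?thesis using Suc by (simp add: expansion_coeff_def div_poly_less)
  qed (use deg in \<open>simp add: expansion_coeff_def mod_poly_less\<close>)
  then have "(\<lambda>i. u (expansion_coeff Q f i * Q ^ i)) ` {..degree f} \<subseteq> {u f, Pinf}"
    and "u f \<in> (\<lambda>i. u (expansion_coeff Q f i * Q ^ i)) ` {..degree f}"
    by (auto simp: valuation_zero[OF u] image_iff intro: bexI[of _ 0])
  then show ?thesis
    unfolding truncation_def expansion_min_def by (intro Min_eqI) auto
qed

section \<open>Discs over an algebraically closed field\<close>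

lemma alg_closed_poly_induct [consumes 1, case_names const linear]:
  fixes f :: "'l::alg_closed_field poly"
  assumes "f \<noteq> 0" "\<And>c. c \<noteq> 0 \<Longrightarrow> P [:c:]"
    and "\<And>\<beta> f. f \<noteq> 0 \<Longrightarrow> P f \<Longrightarrow> P ([:-\<beta>, 1:] * f)"
  shows "P f"
  using assms(1)
proof (induction "degree f" arbitrary: f)
  case 0
  then show ?case using assms(2) by (metis degree_eq_zeroE pCons_0_0)
next
  case (Suc n)
  then obtain \<beta> where "poly f \<beta> = 0" using alg_closed_imp_poly_has_root[of f] by auto
  then obtain g where g: "f = [:-\<beta>, 1:] * g" by (auto simp: poly_eq_0_iff_dvd)
  with Suc.prems have "g \<noteq> 0" by auto
  moreover from this have "degree f = Suc (degree g)"
    unfolding g by (subst degree_mult_eq) auto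
  ultimately show ?case using Suc.hyps assms(3) g by simp
qed

locale alg_closed_poly_valuation =
  fixes p :: "'l::alg_closed_field poly \<Rightarrow> 'g::linordered_ab_group_add extended"
  assumes valuation_p: "valuation p"
    and p_finite: "f \<noteq> 0 \<Longrightarrow> p f \<noteq> Pinf"
begin

definition radius :: "'l \<Rightarrow> 'g extended" where
  "radius \<alpha> = p [:-\<alpha>, 1:]"

text \<open>
  Composition with \<open>X + \<alpha>\<close> exposes the coefficients of the expansion in powers of \<open>X - \<alpha>\<close>: this is
  the Gauss valuation attached to the disc of centre \<open>\<alpha>\<close> and radius \<open>radius \<alpha>\<close>.
\<close>

definition disc_val :: "'l \<Rightarrow> 'l poly \<Rightarrow> 'g extended" where
  "disc_val \<alpha> f = gauss_val (\<lambda>a. p [:a:]) (radius \<alpha>) (f \<circ>\<^sub>p [:\<alpha>, 1:])"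

lemma radius_not_Minf: "radius \<alpha> \<noteq> Minf"
  unfolding radius_def by (rule valuation_not_Minf[OF valuation_p])

lemma radius_finite: "radius \<alpha> \<noteq> Pinf"
  unfolding radius_def by (rule p_finite) simp

lemma valuation_constants: "valuation (\<lambda>a. p [:a:])"
  by (rule valuation_comp[OF valuation_p]) (simp_all add: one_pCons)

lemma valuation_disc_val: "valuation (disc_val \<alpha>)"
  unfolding disc_val_def
  by (rule valuation_comp[OF valuation_gauss_val[OF valuation_constants radius_not_Minf radius_finite]])
     (simp_all add: pcompose_add pcompose_mult pcompose_1)

lemma disc_val_mult: "disc_val \<alpha> (f * g) = disc_val \<alpha> f + disc_val \<alpha> g"
  by (rule valuation_mult[OF valuation_disc_val])

lemma disc_val_const: "disc_val \<alpha> [:c:] = p [:c:]"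
  by (simp add: disc_val_def gauss_val_def)

lemma disc_val_le_centre: "disc_val \<alpha> f \<le> p [:poly f \<alpha>:]"
  unfolding disc_val_def
  using gauss_val_le_coeff[OF valuation_constants radius_not_Minf, of \<alpha> "f \<circ>\<^sub>p [:\<alpha>, 1:]" 0] by simp

text \<open>
  The value of a linear factor depends on the disc only through its radius: by the ultrametric
  inequality, \<open>\<alpha> - \<beta>\<close> and \<open>X - \<beta>\<close> have the same value unless both are at least as large as
  the radius.
\<close>

lemma disc_val_linear: "disc_val \<alpha> [:-\<beta>, 1:] = min (radius \<alpha>) (radius \<beta>)"
proof -
  have "disc_val \<alpha> [:-\<beta>, 1:] = min (p [:\<alpha> - \<beta>:]) (radius \<alpha>)"
    by (simp add: disc_val_def gauss_val_def pcompose_pCons atMost_Suc times_nat_Suc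
        valuation_one[OF valuation_constants] min.commute)
  also have "\<dots> = min (radius \<alpha>) (radius \<beta>)"
  proof (cases "p [:\<alpha> - \<beta>:] < radius \<alpha>")
    case True
    then have "radius \<beta> = p [:\<alpha> - \<beta>:]"
      using valuation_add_eq[OF valuation_p, of "[:\<alpha> - \<beta>:]" "[:-\<alpha>, 1:]"] by (simp add: radius_def)
    then show ?thesis by (simp add: min.commute)
  next
    case False
    then have "radius \<alpha> \<le> radius \<beta>"
      using valuation_add[OF valuation_p, of "[:\<alpha> - \<beta>:]" "[:-\<alpha>, 1:]"]
      by (simp add: radius_def min_def split: if_splits)
    with False show ?thesis by (simp add: min_def)
  qed
  finally show ?thesis .
qed

lemma disc_val_not_Minf: "disc_val \<alpha> f \<noteq> Minf"
  by (rule valuation_not_Minf[OF valuation_disc_val])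

lemma disc_val_linear_mult:
  "disc_val \<alpha> ([:-\<beta>, 1:] * f) = min (radius \<alpha>) (radius \<beta>) + disc_val \<alpha> f"
  unfolding disc_val_mult disc_val_linear ..

lemma p_linear_mult: "p ([:-\<beta>, 1:] * f) = radius \<beta> + p f"
  by (simp only: valuation_mult[OF valuation_p] radius_def)

lemma disc_val_le: "disc_val \<alpha> f \<le> p f"
proof (cases "f = 0")
  case False
  then show ?thesis
  proof (induction rule: alg_closed_poly_induct)
    case (linear \<beta> f)
    then show ?case unfolding disc_val_linear_mult p_linear_mult by (intro add_mono) auto
  qed (simp add: disc_val_const)
qed (simp add: valuation_zero[OF valuation_p])

lemma disc_val_finite: "f \<noteq> 0 \<Longrightarrow> disc_val \<alpha> f \<noteq> Pinf"
  using disc_val_le[of \<alpha> f] p_finite[of f] by auto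

lemma disc_val_mono:
  assumes "radius \<alpha> \<le> radius \<alpha>'"
  shows "disc_val \<alpha> f \<le> disc_val \<alpha>' f"
proof (cases "f = 0")
  case False
  then show ?thesis
  proof (induction rule: alg_closed_poly_induct)
    case (linear \<beta> f)
    then show ?case
      unfolding disc_val_linear_mult by (intro add_mono min.mono assms) auto
  qed (simp add: disc_val_const)
qed (simp add: valuation_zero[OF valuation_disc_val])

lemma min_radius_not_Minf: "min (radius \<alpha>) (radius \<beta>) \<noteq> Minf"
  using radius_not_Minf by (simp add: min_def)

text \<open>
  Relative to \<open>p\<close>, each linear factor \<open>X - \<beta>\<close> of \<open>f\<close> has its value cut off at \<open>radius \<alpha>\<close>. Since all
  values are finite, equality of the totals forces equality in each factor.
\<close>

lemma disc_val_eq_iff: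
  assumes "f \<noteq> 0"
  shows "disc_val \<alpha> f = p f \<longleftrightarrow> (\<forall>\<beta>. poly f \<beta> = 0 \<longrightarrow> radius \<beta> \<le> radius \<alpha>)"
  using assms
proof (induction rule: alg_closed_poly_induct)
  case (linear \<beta> f)
  have fin: "disc_val \<alpha> ([:-\<beta>, 1:] * f) \<noteq> Pinf"
    using linear.hyps by (intro disc_val_finite) (simp only: mult_eq_0_iff, simp)
  have "disc_val \<alpha> ([:-\<beta>, 1:] * f) = p ([:-\<beta>, 1:] * f) \<longleftrightarrow>
      min (radius \<alpha>) (radius \<beta>) = radius \<beta> \<and> disc_val \<alpha> f = p f"
    using extended_add_eq_imp_eq[of "min (radius \<alpha>) (radius \<beta>)" "disc_val \<alpha> f" "radius \<beta>" "p f"]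
      fin disc_val_le[of \<alpha> f] min_radius_not_Minf disc_val_not_Minf
    unfolding disc_val_linear_mult p_linear_mult by auto
  then show ?case using linear.IH by (auto simp: min_def split: if_splits)
qed (simp add: disc_val_const)

text \<open>
  Discs of two different radii give \<open>f\<close> the same value only if no root of \<open>f\<close> is affected by
  cutting off at the smaller radius.
\<close>

lemma disc_val_eq_imp_eq:
  assumes "f \<noteq> 0" "radius \<alpha> < radius \<alpha>'" "disc_val \<alpha> f = disc_val \<alpha>' f"
  shows "disc_val \<alpha> f = p f"
  using assms(1,3)
proof (induction rule: alg_closed_poly_induct)
  case (linear \<beta> f)
  have fin: "disc_val \<alpha> ([:-\<beta>, 1:] * f) \<noteq> Pinf"
    using linear.hyps by (intro disc_val_finite) (simp only: mult_eq_0_iff, simp)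
  have "min (radius \<alpha>) (radius \<beta>) = min (radius \<alpha>') (radius \<beta>) \<and> disc_val \<alpha> f = disc_val \<alpha>' f"
    using linear.prems fin assms(2) disc_val_mono[of \<alpha> \<alpha>' f] min_radius_not_Minf disc_val_not_Minf
    unfolding disc_val_linear_mult by (intro extended_add_eq_imp_eq) (auto intro: min.coboundedI1)
  moreover from this have "min (radius \<alpha>) (radius \<beta>) = radius \<beta>"
    using assms(2) by (auto simp: min_def split: if_splits)
  ultimately show ?case
    using linear.IH unfolding disc_val_linear_mult p_linear_mult by simp
qed (simp add: disc_val_const)

text \<open>
  A polynomial all of whose roots lie outside the disc around \<open>\<alpha>\<close> is constant up to elements of
  larger value.
\<close>

lemma disc_val_diff_centre_gt:
  assumes "f \<noteq> 0" "\<And>\<beta>. poly f \<beta> = 0 \<Longrightarrow> radius \<beta> < radius \<alpha>"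
  shows "disc_val \<alpha> f < disc_val \<alpha> (f - [:poly f \<alpha>:])"
  using assms
proof (induction rule: alg_closed_poly_induct)
  case (const c)
  then show ?case
    using disc_val_finite[of "[:c:]" \<alpha>]
    by (cases "disc_val \<alpha> [:c:]") (auto simp: valuation_zero[OF valuation_disc_val] disc_val_not_Minf)
next
  case (linear \<beta> f)
  define c where "c = poly f \<alpha>"
  have IH: "disc_val \<alpha> f < disc_val \<alpha> (f - [:c:])"
    unfolding c_def using linear.prems by (intro linear.IH) auto
  have "radius \<beta> < radius \<alpha>" by (intro linear.prems) simp
  then have lin: "disc_val \<alpha> [:-\<beta>, 1:] < disc_val \<alpha> [:-\<alpha>, 1:]"
    by (simp add: disc_val_linear)
  have fin: "disc_val \<alpha> f \<noteq> Pinf" "disc_val \<alpha> [:-\<beta>, 1:] \<noteq> Pinf"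
    using linear.hyps by (auto intro!: disc_val_finite)
  have c: "disc_val \<alpha> [:c:] = disc_val \<alpha> f"
    using IH by (rule valuation_diff_gt_imp_eq[OF valuation_disc_val])
  have eq: "[:-\<beta>, 1:] * f - [:poly ([:-\<beta>, 1:] * f) \<alpha>:] =
      [:-\<beta>, 1:] * (f - [:c:]) + [:-\<alpha>, 1:] * [:c:]"
    by (simp add: c_def algebra_simps smult_diff_right)
  have "disc_val \<alpha> ([:-\<beta>, 1:] * f) < disc_val \<alpha> ([:-\<beta>, 1:] * (f - [:c:]))"
    using extended_add_strict_mono[OF IH order_refl, of "disc_val \<alpha> [:-\<beta>, 1:]"] fin
    by (simp add: disc_val_mult disc_val_not_Minf add.commute del: mult_pCons_left)
  moreover have "disc_val \<alpha> ([:-\<beta>, 1:] * f) < disc_val \<alpha> ([:-\<alpha>, 1:] * [:c:])"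
    using extended_add_strict_mono[OF lin order_refl, of "disc_val \<alpha> f"] fin c
    by (simp add: disc_val_mult disc_val_not_Minf del: mult_pCons_left mult_pCons_right)
  ultimately have "disc_val \<alpha> ([:-\<beta>, 1:] * f) <
      min (disc_val \<alpha> ([:-\<beta>, 1:] * (f - [:c:]))) (disc_val \<alpha> ([:-\<alpha>, 1:] * [:c:]))" by simp
  also have "\<dots> \<le> disc_val \<alpha> ([:-\<beta>, 1:] * (f - [:c:]) + [:-\<alpha>, 1:] * [:c:])"
    by (rule valuation_add[OF valuation_disc_val])
  finally show ?case unfolding eq .
qed

end

section \<open>Truncations at abstract key polynomials\<close>

locale common_extension_setting =
  fixes v :: "'k::field \<Rightarrow> 'g::linordered_ab_group_add extended"
    and w :: "'k poly fract \<Rightarrow> 'g extended"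
    and vbar :: "'k alg_closure \<Rightarrow> 'g extended"
    and wbar :: "'k alg_closure poly fract \<Rightarrow> 'g extended"
  assumes common_extension: "common_extension v w vbar wbar"
begin

abbreviation u :: "'k poly \<Rightarrow> 'g extended" where "u \<equiv> on_polys w"

abbreviation ext :: "'k poly \<Rightarrow> 'k alg_closure poly" where "ext \<equiv> map_poly to_ac"

lemma valuation_w: "valuation w" and valuation_wbar: "valuation wbar"
  using common_extension by (auto simp: common_extension_def)

sublocale alg_closed_poly_valuation "\<lambda>f. wbar (to_fract f)"
proof
  show "valuation (\<lambda>f. wbar (to_fract f))"
    by (rule valuation_comp[OF valuation_wbar]) simp_all
  show "wbar (to_fract f) \<noteq> Pinf" if "f \<noteq> 0" for f
    using that by (intro valuation_field_finite valuation_wbar) simp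
qed

lemma valuation_u: "valuation u"
  unfolding on_polys_def by (rule valuation_comp[OF valuation_w]) simp_all

lemma u_eq: "u f = wbar (to_fract (ext f))"
proof -
  have "wbar (to_fract (ext f) / to_fract (ext 1)) = w (to_fract f / to_fract 1)"
    using common_extension unfolding common_extension_def by (metis one_neq_zero)
  then show ?thesis by (simp add: on_polys_def)
qed

lemma u_finite: "f \<noteq> 0 \<Longrightarrow> u f \<noteq> Pinf"
  unfolding on_polys_def by (intro valuation_field_finite valuation_w) simp

lemma u_const: "u [:c:] = v c"
  using common_extension by (simp add: common_extension_def on_polys_def)

lemma ext_add: "ext (f + g) = ext f + ext g"
  by (rule poly_eqI) (simp add: coeff_map_poly)

lemma ext_mult: "ext (f * g) = ext f * ext g"
  by (rule poly_eqI) (simp add: coeff_map_poly coeff_mult to_ac_sum)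

lemma ext_eq_0_iff [simp]: "ext f = 0 \<longleftrightarrow> f = 0"
  by (auto simp: poly_eq_iff coeff_map_poly)

lemma valuation_ext: "valuation z \<Longrightarrow> valuation (\<lambda>f. z (ext f))"
  by (rule valuation_comp) (simp_all add: ext_add ext_mult)

lemma finite_roots_ext: "f \<noteq> 0 \<Longrightarrow> finite {\<alpha>. poly (ext f) \<alpha> = 0}"
  by (simp add: poly_roots_finite)

lemma root_radius_le:
  assumes "f \<noteq> 0" "poly (ext f) \<beta> = 0"
  shows "radius \<beta> \<le> \<delta> wbar f"
  unfolding \<delta>_def radius_def using assms finite_roots_ext by (intro Max_ge) auto

lemma ex_root_radius_eq:
  assumes "degree f > 0"
  shows "\<exists>\<alpha>. poly (ext f) \<alpha> = 0 \<and> radius \<alpha> = \<delta> wbar f"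
proof -
  have "degree (ext f) > 0" using assms by (simp add: degree_map_poly)
  then have "{\<alpha>. poly (ext f) \<alpha> = 0} \<noteq> {}" using alg_closed_imp_poly_has_root by auto
  moreover have "f \<noteq> 0" using assms by auto
  ultimately have "\<delta> wbar f \<in> (\<lambda>\<alpha>. wbar (to_fract [:-\<alpha>, 1:])) ` {\<alpha>. poly (ext f) \<alpha> = 0}"
    unfolding \<delta>_def using finite_roots_ext by (intro Max_in) auto
  then show ?thesis by (auto simp: radius_def)
qed

definition centre :: "'k poly \<Rightarrow> 'k alg_closure" where
  "centre Q = (SOME \<alpha>. poly (ext Q) \<alpha> = 0 \<and> radius \<alpha> = \<delta> wbar Q)"

lemma centre:
  assumes "abkp wbar Q"
  shows "poly (ext Q) (centre Q) = 0" "radius (centre Q) = \<delta> wbar Q"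
proof -
  have "poly (ext Q) (centre Q) = 0 \<and> radius (centre Q) = \<delta> wbar Q"
    unfolding centre_def by (rule someI_ex, rule ex_root_radius_eq) (use assms in \<open>simp add: abkp_def\<close>)
  then show "poly (ext Q) (centre Q) = 0" "radius (centre Q) = \<delta> wbar Q" by auto
qed

lemma abkp_nonzero: "abkp wbar Q \<Longrightarrow> Q \<noteq> 0"
  by (auto simp: abkp_def)

lemma low_degree_root_radius:
  assumes "abkp wbar Q" "degree a < degree Q" "a \<noteq> 0" "poly (ext a) \<beta> = 0"
  shows "radius \<beta> < radius (centre Q)"
proof -
  have "degree a \<noteq> 0"
  proof
    assume "degree a = 0"
    then obtain c where "a = [:c:]" by (rule degree_eq_zeroE)
    then show False using assms(3,4) by (simp add: map_poly_pCons)
  qed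
  then have "\<delta> wbar a < \<delta> wbar Q" using assms(1,2) by (simp add: abkp_def)
  then show ?thesis using root_radius_le[OF assms(3,4)] centre(2)[OF assms(1)] by simp
qed

lemma low_degree_disc_val:
  assumes Q: "abkp wbar Q" and a: "degree a < degree Q"
  shows "disc_val (centre Q) (ext a) = u a"
    and "disc_val (centre Q) (ext a) = wbar (to_fract [:poly (ext a) (centre Q):])"
proof -
  have "disc_val (centre Q) (ext a) = u a \<and>
      disc_val (centre Q) (ext a) = wbar (to_fract [:poly (ext a) (centre Q):])"
  proof (cases "a = 0")
    case True
    then show ?thesis
      by (simp add: valuation_zero[OF valuation_disc_val] valuation_zero[OF valuation_u]
          valuation_zero[OF valuation_wbar])
  next
    case False
    note roots = low_degree_root_radius[OF Q a False]
    have "disc_val (centre Q) (ext a) = u a"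
      using False roots disc_val_eq_iff[of "ext a" "centre Q"] by (auto simp: u_eq less_imp_le)
    moreover have "disc_val (centre Q) (ext a) <
        disc_val (centre Q) (ext a - [:poly (ext a) (centre Q):])"
      using False roots by (intro disc_val_diff_centre_gt) auto
    then have "disc_val (centre Q) [:poly (ext a) (centre Q):] = disc_val (centre Q) (ext a)"
      by (rule valuation_diff_gt_imp_eq[OF valuation_disc_val])
    ultimately show ?thesis by (simp add: disc_val_const)
  qed
  then show "disc_val (centre Q) (ext a) = u a"
    and "disc_val (centre Q) (ext a) = wbar (to_fract [:poly (ext a) (centre Q):])" by auto
qed

lemma disc_val_self:
  assumes Q: "abkp wbar Q"
  shows "disc_val (centre Q) (ext Q) = u Q"
  using abkp_nonzero[OF Q] root_radius_le[of Q] centre(2)[OF Q] disc_val_eq_iff[of "ext Q" "centre Q"]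
  by (auto simp: u_eq)

lemma valuation_at: "valuation (\<lambda>f. wbar (to_fract [:poly (ext f) \<alpha>:]))"
  by (rule valuation_comp[OF valuation_wbar])
     (simp_all add: ext_add ext_mult flip: one_pCons to_fract_add to_fract_mult)

lemma disc_val_self_less_at:
  assumes Q: "abkp wbar Q"
  shows "disc_val (centre Q) (ext Q) < wbar (to_fract [:poly (ext Q) (centre Q):])"
  using disc_val_finite[of "ext Q" "centre Q"] disc_val_not_Minf[of "centre Q" "ext Q"]
    abkp_nonzero[OF Q] centre(1)[OF Q]
  by (cases "disc_val (centre Q) (ext Q)") (auto simp: valuation_zero[OF valuation_wbar])

lemma truncation_eq_disc_val:
  assumes Q: "abkp wbar Q"
  shows "truncation u Q = (\<lambda>f. disc_val (centre Q) (ext f))"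
proof (rule truncation_eqI[where P = "\<lambda>f. wbar (to_fract [:poly (ext f) (centre Q):])"])
  show "wbar (to_fract [:poly (ext Q) (centre Q):]) = Pinf"
    using centre(1)[OF Q] by (simp add: valuation_zero[OF valuation_wbar])
  show "degree Q > 0" using Q by (simp add: abkp_def)
qed (use Q in \<open>auto intro: valuation_u valuation_ext valuation_disc_val valuation_at
      disc_val_le_centre low_degree_disc_val disc_val_self\<close>)

lemma valuation_truncation: "abkp wbar Q \<Longrightarrow> valuation (truncation u Q)"
  by (simp add: truncation_eq_disc_val valuation_ext valuation_disc_val)

lemma truncation_le: "abkp wbar Q \<Longrightarrow> truncation u Q f \<le> u f"
  by (simp add: truncation_eq_disc_val u_eq disc_val_le)

lemma truncation_self: "abkp wbar Q \<Longrightarrow> truncation u Q Q = u Q"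
  by (simp add: truncation_eq_disc_val disc_val_self)

lemma truncation_mono:
  assumes "abkp wbar Q" "abkp wbar Q'" "\<delta> wbar Q \<le> \<delta> wbar Q'"
  shows "truncation u Q f \<le> truncation u Q' f"
  using assms by (simp add: truncation_eq_disc_val centre disc_val_mono)

lemma truncation_less:
  assumes Q: "abkp wbar Q" and Q': "abkp wbar Q'" and less: "\<delta> wbar Q < \<delta> wbar Q'"
  shows "truncation u Q Q' < u Q'"
proof -
  have "\<not> radius (centre Q') \<le> radius (centre Q)"
    using less by (simp add: centre[OF Q] centre[OF Q'])
  then have "disc_val (centre Q) (ext Q') \<noteq> u Q'"
    using disc_val_eq_iff[of "ext Q'" "centre Q"] centre(1)[OF Q'] abkp_nonzero[OF Q']
    by (auto simp: u_eq)
  then show ?thesis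
    using truncation_le[OF Q, of Q'] by (simp add: truncation_eq_disc_val[OF Q] less_le)
qed

lemma truncation_eq_imp_eq:
  assumes Q: "abkp wbar Q" and Q': "abkp wbar Q'" and less: "\<delta> wbar Q < \<delta> wbar Q'"
    and eq: "truncation u Q f = truncation u Q' f"
  shows "truncation u Q f = u f"
proof (cases "f = 0")
  case True
  then show ?thesis
    using Q by (simp add: valuation_zero[OF valuation_u] valuation_zero valuation_truncation)
next
  case False
  then show ?thesis
    using less eq disc_val_eq_imp_eq[of "ext f" "centre Q" "centre Q'"]
    by (simp add: truncation_eq_disc_val[OF Q] truncation_eq_disc_val[OF Q'] centre[OF Q] centre[OF Q'] u_eq)
qed

text \<open>
  This is the criterion on least degrees, applied to the evaluation at the centre of the
  disc as the larger valuation: it agrees with the truncation below the degree of \<open>Q\<close> and is infinite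
  at \<open>Q\<close>.
\<close>

lemma abkp_in_KP_truncation:
  assumes Q: "abkp wbar Q"
  shows "Q \<in> KP (truncation u Q)"
  unfolding truncation_eq_disc_val[OF Q]
proof (rule least_degree_less_imp_KP[where u' = "\<lambda>f. wbar (to_fract [:poly (ext f) (centre Q):])"])
  show "monic Q" using Q by (simp add: abkp_def)
qed (use Q in \<open>auto intro: valuation_ext valuation_disc_val valuation_at disc_val_le_centre
      low_degree_disc_val disc_val_self_less_at\<close>)

text \<open>
  Division of \<open>Q\<close> by a nonconstant \<open>f\<close> of smaller degree gives \<open>Q = q f + r\<close>, where \<open>q f\<close> and \<open>r\<close>
  are both constant on the disc up to larger value. These two constants cancel because \<open>Q\<close> vanishes
  at the centre, so \<open>r\<close> has smaller value than \<open>Q\<close>. Consequently no such \<open>f\<close> is a key polynomial for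
  the truncation at \<open>Q\<close>.
\<close>

lemma disc_val_mod_less:
  assumes Q: "abkp wbar Q" and f: "0 < degree f" "degree f < degree Q"
  shows "disc_val (centre Q) (ext (Q mod f)) < disc_val (centre Q) (ext Q)"
proof -
  let ?D = "disc_val (centre Q)"
  define q r where "q = Q div f" and "r = Q mod f"
  define c where "c = poly (ext r) (centre Q)"
  have Q_eq: "Q = q * f + r" by (simp add: q_def r_def)
  have f0: "f \<noteq> 0" using f by auto
  have degs: "degree q < degree Q" "degree r < degree Q"
  proof -
    show "degree q < degree Q" using f by (simp add: q_def degree_div_less)
    show "degree r < degree Q"
      using f degree_mod_less'[of f Q] f0 by (cases "r = 0") (auto simp: r_def)
  qed
  have q0: "q \<noteq> 0" using f by (auto simp: q_def div_poly_eq_0_iff)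
  have qf_roots: "radius \<beta> < radius (centre Q)" if "poly (ext (q * f)) \<beta> = 0" for \<beta>
    using that low_degree_root_radius[OF Q degs(1) q0] low_degree_root_radius[OF Q f(2) f0]
    by (auto simp: ext_mult)
  have qf_c: "poly (ext (q * f)) (centre Q) = - c"
    using centre(1)[OF Q] unfolding Q_eq c_def by (simp add: ext_add eq_neg_iff_add_eq_0)
  then have "c \<noteq> 0" using qf_roots[of "centre Q"] by auto
  then have r0: "r \<noteq> 0" by (auto simp: c_def)
  have gt_qf: "?D (ext (q * f)) < ?D (ext (q * f) - [:- c:])"
    using disc_val_diff_centre_gt[of "ext (q * f)" "centre Q"] qf_roots qf_c q0 f0 by simp
  have gt_r: "?D (ext r) < ?D (ext r - [:c:])"
    unfolding c_def using low_degree_root_radius[OF Q degs(2) r0] r0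
    by (intro disc_val_diff_centre_gt) auto
  have "?D (ext (q * f)) = ?D [:- c:]" "?D (ext r) = ?D [:c:]"
    using valuation_diff_gt_imp_eq[OF valuation_disc_val gt_qf]
      valuation_diff_gt_imp_eq[OF valuation_disc_val gt_r] by auto
  moreover have "?D [:- c:] = ?D [:c:]"
    using valuation_uminus[OF valuation_disc_val, of "centre Q" "[:c:]"] by simp
  ultimately have "?D (ext r) < min (?D (ext (q * f) - [:- c:])) (?D (ext r - [:c:]))"
    using gt_qf gt_r by simp
  also have "\<dots> \<le> ?D ((ext (q * f) - [:- c:]) + (ext r - [:c:]))"
    by (rule valuation_add[OF valuation_disc_val])
  also have "(ext (q * f) - [:- c:]) + (ext r - [:c:]) = ext Q"
    unfolding Q_eq ext_add by (simp add: algebra_simps)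
  finally show ?thesis by (simp add: r_def)
qed

lemma deg_val_truncation:
  assumes Q: "abkp wbar Q"
  shows "deg_val (truncation u Q) = degree Q"
  unfolding deg_val_def
proof (rule Least_equality)
  show "\<exists>f\<in>KP (truncation u Q). degree f = degree Q"
    using abkp_in_KP_truncation[OF Q] by blast
  fix d
  assume "\<exists>f\<in>KP (truncation u Q). degree f = d"
  then obtain f where f: "f \<in> KP (truncation u Q)" "degree f = d" by blast
  show "degree Q \<le> d"
    using KP_degree_ge[OF valuation_truncation[OF Q] f(1), of Q] disc_val_mod_less[OF Q] f(2)
    by (simp add: truncation_eq_disc_val[OF Q])
qed

text \<open>
  If the truncation at \<open>Q\<close> agrees with \<open>w\<close> below the degree of \<open>Q'\<close>, then \<open>Q'\<close> is a key polynomial for it, and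
  the coefficients of \<open>Q'\<close>-expansions have the same value for it as for \<open>w\<close>, so augmenting it by
  \<open>Q'\<close> is truncating \<open>w\<close> at \<open>Q'\<close>.
\<close>

lemma ordinary_augmentation_truncation:
  assumes Q: "abkp wbar Q" and Q': "abkp wbar Q'" and less: "\<delta> wbar Q < \<delta> wbar Q'"
    and low: "\<And>f. degree f < degree Q' \<Longrightarrow> truncation u Q f = u f"
  shows "ordinary_augmentation (truncation u Q) Q' (u Q') (truncation u Q')"
proof -
  have "Q' \<in> KP (truncation u Q)"
  proof (rule least_degree_less_imp_KP[where u' = u])
    show "monic Q'" using Q' by (simp add: abkp_def)
  qed (use assms in \<open>auto intro: valuation_truncation valuation_u truncation_le truncation_less\<close>)
  moreover have "truncation u Q' = augment (truncation u Q) Q' (u Q')"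
    unfolding augment_def using Q' low
    by (intro expansion_min_eq_truncation[symmetric]) (auto simp: valuation_u abkp_def)
  ultimately show ?thesis
    using truncation_less[OF Q Q' less] u_finite[OF abkp_nonzero[OF Q']]
    by (simp add: ordinary_augmentation_def)
qed

lemma deg_Phi_truncation:
  assumes le: "\<And>f. u' f \<le> u f"
    and low: "\<And>f. degree f < n \<Longrightarrow> truncation u Q f = u f"
    and g: "monic g" "degree g = n" "truncation u Q g < u' g"
  shows "deg_Phi (truncation u Q) u' = n"
  unfolding deg_Phi_def
proof (rule Least_equality)
  show "\<exists>g. monic g \<and> truncation u Q g < u' g \<and> degree g = n" using g by blast
  fix d
  assume "\<exists>h. monic h \<and> truncation u Q h < u' h \<and> degree h = d"
  then obtain h where h: "truncation u Q h < u' h" "degree h = d" by blast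
  then have "truncation u Q h \<noteq> u h" using le[of h] by auto
  then show "n \<le> d" using low[of h] h(2) by (meson not_le)
qed

text \<open>
  Since \<open>X\<close> has a root in \<open>K\<close>, the valuation that isolates constant terms can be taken to be
  evaluation at \<open>0\<close>, and no passage to the algebraic closure occurs.
\<close>

lemma truncation_X_eq_gauss_val: "truncation u [:0, 1:] = gauss_val v (u [:0, 1:])"
proof (rule truncation_eqI[where P = "\<lambda>f. v (poly f 0)"])
  have v: "valuation v" using common_extension by (simp add: common_extension_def)
  have X: "u [:0, 1:] \<noteq> Minf" "u [:0, 1:] \<noteq> Pinf"
    using u_finite[of "[:0, 1:]"] by (auto simp: valuation_not_Minf[OF valuation_u])
  show "valuation (gauss_val v (u [:0, 1:]))" by (rule valuation_gauss_val[OF v X])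
  show "valuation (\<lambda>f. v (poly f 0))" by (rule valuation_comp[OF v]) simp_all
  show "gauss_val v (u [:0, 1:]) f \<le> v (poly f 0)" for f
    using gauss_val_le_coeff[OF v X(1), of f 0] by (simp add: poly_0_coeff_0)
  show "gauss_val v (u [:0, 1:]) [:0, 1:] = u [:0, 1:]"
    by (simp add: gauss_val_def atMost_Suc times_nat_Suc valuation_zero[OF v] valuation_one[OF v])
  fix a :: "'k poly"
  assume "degree a < degree [:0::'k, 1:]"
  then obtain c where "a = [:c:]" using degree_eq_zeroE[of a] by auto
  then show "gauss_val v (u [:0, 1:]) a = v (poly a 0)" "gauss_val v (u [:0, 1:]) a = u a"
    by (simp_all add: gauss_val_def u_const)
qed (use common_extension in \<open>simp_all add: valuation_u common_extension_def valuation_zero\<close>)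

lemma depth_zero_truncation_X: "depth_zero v (truncation u [:0, 1:])"
  unfolding depth_zero_def truncation_X_eq_gauss_val
proof (intro exI[of _ "0::'k"] exI[of _ "u [:0, 1:]"] conjI allI)
  show X: "u [:0, 1:] \<noteq> Minf" by (rule valuation_not_Minf[OF valuation_u])
  have v: "valuation v" using common_extension by (simp add: common_extension_def)
  fix n and c :: "nat \<Rightarrow> 'k"
  define f where "f = (\<Sum>i\<le>n. smult (c i) ([:- 0, 1:] ^ i))"
  have f: "coeff f i = (if i \<le> n then c i else 0)" for i
    by (simp add: f_def coeff_sum flip: monom_altdef)
  have "d \<le> gauss_val v (u [:0, 1:]) f \<longleftrightarrow>
      d \<le> Min ((\<lambda>i. v (c i) + times_nat i (u [:0, 1:])) ` {..n})" for d
  proof -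
    have "d \<le> v (coeff f i) + times_nat i (u [:0, 1:])" if "i > n" for i
      using that times_nat_not_Minf[OF X, of i]
      by (cases "times_nat i (u [:0, 1:])") (auto simp: f valuation_zero[OF v])
    then show ?thesis
      unfolding le_gauss_val_iff[OF v X] by (auto simp: f)
  qed
  then have "gauss_val v (u [:0, 1:]) f = Min ((\<lambda>i. v (c i) + times_nat i (u [:0, 1:])) ` {..n})"
    by (metis order.eq_iff)
  then show "gauss_val v (u [:0, 1:]) (\<Sum>i\<le>n. smult (c i) ([:- 0, 1:] ^ i)) =
      Min ((\<lambda>i. v (c i) + times_nat i (u [:0, 1:])) ` {..n})"
    by (simp add: f_def)
qed

end

section \<open>The chain of a complete set with a last element\<close>

locale complete_set_with_last = common_extension_setting v w vbar wbar
  for v :: "'k::field \<Rightarrow> 'g::linordered_ab_group_add extended"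
    and w :: "'k poly fract \<Rightarrow> 'g extended"
    and vbar :: "'k alg_closure \<Rightarrow> 'g extended"
    and wbar :: "'k alg_closure poly fract \<Rightarrow> 'g extended" +
  fixes \<Delta> :: "'i::linorder set" and I :: "nat set"
    and num :: "nat \<Rightarrow> 'i" and \<theta> :: "nat \<Rightarrow> 'i set" and Q :: "'i \<Rightarrow> 'k poly" and N :: nat
  assumes complete: "indexed_complete_set u wbar \<Delta> I num \<theta> Q"
    and N: "N \<in> I" and last: "\<And>i. i \<in> \<Delta> \<Longrightarrow> i \<le> num N"
begin

abbreviation T :: "'i \<Rightarrow> 'k poly \<Rightarrow> 'g extended" where "T i \<equiv> truncation u (Q i)"

lemma complete_abkp_set: "complete_abkp_set u wbar \<Delta> Q"
  using complete unfolding indexed_complete_set_def by (elim conjE)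

lemma num_mono: "strict_mono_on I num"
  using complete unfolding indexed_complete_set_def by (elim conjE)

lemma \<Delta>_eq: "\<Delta> = (\<Union>j\<in>I. block num \<theta> j)"
  using complete unfolding indexed_complete_set_def by (elim conjE)

lemma Q_0: "Q (num 0) = [:0, 1:]"
  using complete unfolding indexed_complete_set_def by (elim conjE)

lemma abkp: "i \<in> \<Delta> \<Longrightarrow> abkp wbar (Q i)"
  using complete_abkp_set unfolding complete_abkp_set_def by (elim conjE bspec)

lemma attained: "\<exists>i\<in>\<Delta>. T i f = u f \<and> (degree f > 0 \<longrightarrow> degree (Q i) \<le> degree f)"
  using complete_abkp_set unfolding complete_abkp_set_def by (elim conjE allE)

lemma no_max:
  assumes "j\<in>I"
  shows "\<not> (\<exists>m\<in>\<theta> j. \<forall>i\<in>\<theta> j. i \<le> m)"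
proof -
  have "\<forall>j\<in>I. \<not> (\<exists>m\<in>\<theta> j. \<forall>i\<in>\<theta> j. i \<le> m)"
    using complete unfolding indexed_complete_set_def by (elim conjE)
  then show ?thesis using assms by blast
qed

lemma between:
  assumes "Suc j\<in>I" "i\<in>\<theta> j"
  shows "num j < i \<and> i < num (Suc j)"
proof -
  have "\<forall>j. Suc j\<in>I \<longrightarrow> (\<forall>i\<in>\<theta> j. num j < i \<and> i < num (Suc j))"
    using complete unfolding indexed_complete_set_def by (elim conjE)
  then show ?thesis using assms by blast
qed

lemma degree_block:
  assumes "j\<in>I" "i\<in>block num \<theta> j" "i'\<in>block num \<theta> j"
  shows "degree (Q i) = degree (Q i')"
proof -
  have "\<forall>j\<in>I. \<forall>i\<in>block num \<theta> j. \<forall>i'\<in>block num \<theta> j. degree (Q i) = degree (Q i')"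
    using complete unfolding indexed_complete_set_def by (elim conjE)
  then show ?thesis using assms by blast
qed

lemma degree_Suc:
  assumes "Suc j\<in>I" "i\<in>block num \<theta> j" "i'\<in>block num \<theta> (Suc j)"
  shows "degree (Q i) < degree (Q i')"
proof -
  have "\<forall>j. Suc j\<in>I \<longrightarrow> (\<forall>i\<in>block num \<theta> j. \<forall>i'\<in>block num \<theta> (Suc j). degree (Q i) < degree (Q i'))"
    using complete unfolding indexed_complete_set_def by (elim conjE)
  then show ?thesis using assms by blast
qed

lemma increasing:
  assumes "i\<in>\<Delta>" "i'\<in>\<Delta>" "i < i'"
  shows "u (Q i) < u (Q i') \<and> \<delta> wbar (Q i) < \<delta> wbar (Q i')"
proof -
  have "\<forall>i\<in>\<Delta>. \<forall>i'\<in>\<Delta>. i < i' \<longrightarrow> u (Q i) < u (Q i') \<and> \<delta> wbar (Q i) < \<delta> wbar (Q i')"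
    using complete unfolding indexed_complete_set_def by (elim conjE)
  then show ?thesis using assms by blast
qed

lemma I_eq: "I = {..N}"
proof -
  have "Suc N \<notin> I"
  proof
    assume "Suc N \<in> I"
    then have "num N < num (Suc N)" and "num (Suc N) \<in> \<Delta>"
      using num_mono N by (auto simp: strict_mono_on_def \<Delta>_eq block_def)
    then show False using last by (meson not_le)
  qed
  moreover have "(\<exists>M. I = {..M}) \<or> I = UNIV"
    using complete by (simp add: indexed_complete_set_def)
  ultimately show ?thesis using N by (auto simp: not_less_eq_eq)
qed

lemma num_in: "j \<le> N \<Longrightarrow> num j \<in> \<Delta>" and \<theta>_in: "j \<le> N \<Longrightarrow> i \<in> \<theta> j \<Longrightarrow> i \<in> \<Delta>"
  by (auto simp: \<Delta>_eq I_eq block_def)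

lemma num_less: "j < j' \<Longrightarrow> j' \<le> N \<Longrightarrow> num j < num j'"
  using num_mono by (auto simp: strict_mono_on_def I_eq)

lemma degree_num_less: "j < j' \<Longrightarrow> j' \<le> N \<Longrightarrow> degree (Q (num j)) < degree (Q (num j'))"
proof (induction j')
  case (Suc n)
  have "degree (Q (num n)) < degree (Q (num (Suc n)))"
    using degree_Suc[of n "num n" "num (Suc n)"] Suc.prems by (simp add: I_eq block_def)
  with Suc show ?case by (cases "j = n") auto
qed simp

lemma degree_\<theta>: "j \<le> N \<Longrightarrow> i \<in> \<theta> j \<Longrightarrow> degree (Q i) = degree (Q (num j))"
  using degree_block[of j i "num j"] by (simp add: I_eq block_def)

lemma degree_Q_pos: "i \<in> \<Delta> \<Longrightarrow> degree (Q i) > 0"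
  using abkp by (auto simp: abkp_def)

lemma T_mono:
  assumes "i \<in> \<Delta>" "i' \<in> \<Delta>" "i \<le> i'"
  shows "T i f \<le> T i' f"
proof (cases "i = i'")
  case False
  then have "\<delta> wbar (Q i) < \<delta> wbar (Q i')" using assms increasing[of i i'] by simp
  then show ?thesis using assms by (intro truncation_mono abkp) auto
qed simp

lemma T_eq_u_mono:
  assumes "i \<in> \<Delta>" "i' \<in> \<Delta>" "i \<le> i'" "T i f = u f"
  shows "T i' f = u f"
  using assms T_mono[of i i' f] truncation_le[OF abkp, of i' f] by auto

lemma T_last: "T (num N) = u"
proof
  fix f
  obtain i where "i \<in> \<Delta>" "T i f = u f" using attained by blast
  then show "T (num N) f = u f" using T_eq_u_mono[of i "num N"] last num_in[of N] by simp
qed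

text \<open>
  Completeness computes the value of \<open>f\<close> at some \<open>Q\<^sub>i\<close> of degree at most \<open>degree f\<close>. Below the degree
  of \<open>Q\<^sub>j\<^sub>+\<^sub>1\<close> this leaves the blocks up to \<open>\<Delta>\<^sub>j\<close>.
\<close>

lemma attained_up_to_block:
  assumes j: "j < N" and f: "degree f < degree (Q (num (Suc j)))"
  shows "T (num j) f = u f \<or> (\<exists>i\<in>\<theta> j. T i f = u f)"
proof (cases "degree f = 0")
  case True
  then show ?thesis
    using truncation_low_degree[OF valuation_u, of f "Q (num j)"] degree_Q_pos[OF num_in[of j]] j
    by simp
next
  case False
  then obtain i where i: "i \<in> \<Delta>" "T i f = u f" "degree (Q i) < degree (Q (num (Suc j)))"
    using attained[of f] f by auto
  then obtain k where k: "k \<le> N" "i \<in> block num \<theta> k" by (auto simp: \<Delta>_eq I_eq)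
  have deg: "degree (Q i) = degree (Q (num k))"
    using degree_\<theta>[of k i] k by (auto simp: block_def)
  have "k \<le> j"
  proof (rule ccontr)
    assume "\<not> k \<le> j"
    then have "Suc j = k \<or> Suc j < k" by auto
    then show False using degree_num_less[of "Suc j" k] k(1) i(3) deg by auto
  qed
  show ?thesis
  proof (cases "k = j \<and> i \<in> \<theta> j")
    case False
    have "i \<le> num j"
    proof (cases "k = j")
      case True
      then show ?thesis using False k(2) by (simp add: block_def)
    next
      case False
      then have "k < j" using \<open>k \<le> j\<close> by simp
      then have "i < num (Suc k)"
        using between[of k i] num_less[of k "Suc k"] k(2) j by (auto simp: block_def I_eq)
      also have "num (Suc k) \<le> num j"
        using \<open>k < j\<close> num_less[of "Suc k" j] j by (cases "Suc k = j") (auto intro: less_imp_le)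
      finally show ?thesis by simp
    qed
    then show ?thesis using T_eq_u_mono[of i "num j"] i num_in[of j] j by simp
  qed (use i in auto)
qed

lemma ordinary_step:
  assumes j: "j < N" and empty: "\<theta> j = {}"
  shows "is_mlv_step Ordinary (T (num j)) (Q (num j)) (Q (num (Suc j))) (u (Q (num (Suc j))))
           (T (num (Suc j)))"
proof -
  have in_\<Delta>: "num j \<in> \<Delta>" "num (Suc j) \<in> \<Delta>" using j by (auto intro: num_in)
  note abkps = in_\<Delta>[THEN abkp]
  have less: "\<delta> wbar (Q (num j)) < \<delta> wbar (Q (num (Suc j)))"
    using increasing[OF in_\<Delta>] num_less[of j "Suc j"] j by simp
  have low: "T (num j) f = u f" if "degree f < degree (Q (num (Suc j)))" for f
    using attained_up_to_block[OF j that] empty by simp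
  have "deg_Phi (T (num j)) (T (num (Suc j))) = degree (Q (num (Suc j)))"
  proof (rule deg_Phi_truncation)
    show "monic (Q (num (Suc j)))" using abkps(2) by (simp add: abkp_def)
    show "T (num j) (Q (num (Suc j))) < T (num (Suc j)) (Q (num (Suc j)))"
      using truncation_less[OF abkps less] by (simp add: truncation_self[OF abkps(2)])
  qed (use in_\<Delta> abkps low in \<open>auto intro: truncation_le degree_Q_pos\<close>)
  then show ?thesis
    using ordinary_augmentation_truncation[OF abkps less low] deg_val_truncation[OF abkps(1)]
      degree_num_less[of j "Suc j"] j by simp
qed

text \<open>
  Along a nonempty \<open>\<theta>\<^sub>j\<close> all degrees agree, so every truncation there augments the preceding ones. Below
  the degree of \<open>Q\<^sub>j\<^sub>+\<^sub>1\<close> the truncations stabilise at \<open>w\<close>. They do not stabilise at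
  \<open>Q\<^sub>j\<^sub>+\<^sub>1\<close>: two equal values would both be \<open>w Q\<^sub>j\<^sub>+\<^sub>1\<close>, which no earlier truncation reaches.
\<close>

lemma limit_step:
  assumes j: "j < N" and nonempty: "\<theta> j \<noteq> {}"
  shows "is_mlv_step (Limit (\<theta> j) Q (\<lambda>i. u (Q i))) (T (num j)) (Q (num j)) (Q (num (Suc j)))
           (u (Q (num (Suc j)))) (T (num (Suc j)))"
proof -
  define d where "d = degree (Q (num (Suc j)))"
  have in_\<Delta>: "num j \<in> \<Delta>" "num (Suc j) \<in> \<Delta>" using j by (auto intro: num_in)
  have \<theta>: "i \<in> \<Delta>" "num j < i" "i < num (Suc j)" "degree (Q i) = degree (Q (num j))" if "i \<in> \<theta> j" for i
    using that j between[of j i] \<theta>_in[of j i] degree_\<theta>[of j i] by (auto simp: I_eq)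
  have ex_greater: "\<exists>i'\<in>\<theta> j. i < i'" if "i \<in> \<theta> j" for i
    using no_max[of j] that j by (auto simp: I_eq) (meson not_le)
  have low: "T i f = u f" if "i \<in> \<Delta>" "degree f < degree (Q i)" for i f
    using that by (intro truncation_low_degree valuation_u)
  have augments: "ordinary_augmentation (T i) (Q i') (u (Q i')) (T i')"
    if "i \<in> \<Delta>" "i' \<in> \<theta> j" "i < i'" "degree (Q i) = degree (Q i')" for i i'
    using that increasing[of i i'] \<theta>(1)[of i'] low[of i]
    by (intro ordinary_augmentation_truncation abkp) auto
  have T_eq: "augment (T (num j)) (Q i) (u (Q i)) = T i" if "i \<in> \<theta> j" for i
    using augments[of "num j" i] in_\<Delta> \<theta>[OF that] that by (simp add: ordinary_augmentation_def)
  have continuous: "continuous_family (T (num j)) (\<theta> j) Q (\<lambda>i. u (Q i))"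
    unfolding continuous_family_def
  proof (intro conjI ballI impI)
    fix i i' assume i: "i \<in> \<theta> j" "i' \<in> \<theta> j"
    then show "degree (Q i) = degree (Q i')" using \<theta> by simp
    assume "i < i'"
    show "ordinary_augmentation (augment (T (num j)) (Q i) (u (Q i))) (Q i') (u (Q i'))
            (augment (T (num j)) (Q i') (u (Q i')))"
      using augments[of i i'] i \<open>i < i'\<close> \<theta> by (simp add: T_eq)
    \<comment> \<open>The difference of two members has degree below theirs, so its value is that of the member
      of smaller value.\<close>
    have "u (Q i' - Q i) = u (Q i)"
      using valuation_add_eq[OF valuation_u, of "- Q i" "Q i'"] increasing[of i i'] i \<open>i < i'\<close> \<theta>
      by (simp add: valuation_uminus[OF valuation_u])
    moreover have "degree (Q i' - Q i) < degree (Q i)"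
    proof -
      have "degree (Q i' - Q i) \<le> degree (Q i)" using i \<theta> by (intro degree_diff_le) auto
      moreover have "coeff (Q i' - Q i) (degree (Q i)) = 0"
        using i \<theta> abkp[of i] abkp[of i'] by (simp add: abkp_def monic_def)
      ultimately show ?thesis
        using eq_zero_or_degree_less[of "Q i' - Q i" "degree (Q i)"] degree_Q_pos[of i] i \<theta> by auto
    qed
    ultimately have "T i (Q i' - Q i) = u (Q i)" using low[of i] i \<theta> by simp
    then show "\<not> val_equiv (augment (T (num j)) (Q i) (u (Q i))) (Q i') (Q i)"
      using i \<theta> by (auto simp: T_eq val_equiv_def truncation_self abkp)
  next
    show "\<not> (\<exists>m\<in>\<theta> j. \<forall>i\<in>\<theta> j. i \<le> m)" using no_max[of j] j by (simp add: I_eq)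
  next
    fix i assume "i \<in> \<theta> j"
    then show "ordinary_augmentation (T (num j)) (Q i) (u (Q i)) (augment (T (num j)) (Q i) (u (Q i)))"
      using augments[of "num j" i] in_\<Delta> \<theta> by (simp add: T_eq)
  qed (use nonempty in auto)
  let ?\<rho> = "\<lambda>i. augment (T (num j)) (Q i) (u (Q i))"
  have stable: "has_stable_value ?\<rho> (\<theta> j) f (u f)" if f: "degree f < d" for f
  proof -
    have "T (num j) f = u f \<or> (\<exists>i\<in>\<theta> j. T i f = u f)"
      using attained_up_to_block[OF j] f by (simp add: d_def)
    then obtain i0 where i0: "i0 \<in> \<theta> j" "T i0 f = u f"
      using nonempty T_eq_u_mono[of "num j" _ f] in_\<Delta> \<theta> by (metis all_not_in_conv less_imp_le)
    then show ?thesis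
      unfolding has_stable_value_def using T_eq_u_mono[of i0 _ f] \<theta> by (auto simp: T_eq intro!: bexI[of _ i0])
  qed
  have stable_value: "stable_value ?\<rho> (\<theta> j) f = u f" if f: "degree f < d" for f
    unfolding stable_value_def
  proof (rule the_equality[where P = "has_stable_value ?\<rho> (\<theta> j) f"])
    show "has_stable_value ?\<rho> (\<theta> j) f (u f)" by (rule stable[OF f])
    show "c = u f" if "has_stable_value ?\<rho> (\<theta> j) f c" for c
      using that stable[OF f] unfolding has_stable_value_def by (metis linear)
  qed
  have unreached: "T i (Q (num (Suc j))) < u (Q (num (Suc j)))" if "i \<in> \<theta> j" for i
    using that \<theta> in_\<Delta> increasing[of i "num (Suc j)"] by (auto intro!: truncation_less abkp)
  have unstable: "\<not> stable ?\<rho> (\<theta> j) (Q (num (Suc j)))"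
  proof
    assume "stable ?\<rho> (\<theta> j) (Q (num (Suc j)))"
    then obtain c i where i: "i \<in> \<theta> j" "\<And>k. k \<in> \<theta> j \<Longrightarrow> i \<le> k \<Longrightarrow> T k (Q (num (Suc j))) = c"
      by (auto simp: stable_def has_stable_value_def T_eq)
    obtain k where k: "k \<in> \<theta> j" "i < k" using ex_greater[OF i(1)] by blast
    have "T i (Q (num (Suc j))) = T k (Q (num (Suc j)))"
      using i(2)[OF i(1)] i(2)[OF k(1)] k(2) by simp
    then have "T i (Q (num (Suc j))) = u (Q (num (Suc j)))"
      using truncation_eq_imp_eq[OF abkp abkp] increasing[of i k] i(1) k \<theta> by blast
    then show False using unreached[OF i(1)] by simp
  qed
  have unstable_degree: "unstable_degree ?\<rho> (\<theta> j) = d"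
    unfolding unstable_degree_def
  proof (rule Least_equality)
    show "\<exists>f. \<not> stable ?\<rho> (\<theta> j) f \<and> degree f = d" using unstable by (auto simp: d_def)
    show "d \<le> n" if "\<exists>f. \<not> stable ?\<rho> (\<theta> j) f \<and> degree f = n" for n
      using that stable by (meson not_le stable_def)
  qed
  have degree_less: "degree (Q (num j)) < d"
    using degree_num_less[of j "Suc j"] j by (simp add: d_def)
  have "limit_augmentation (T (num j)) (\<theta> j) Q (\<lambda>i. u (Q i)) (Q (num (Suc j)))
      (u (Q (num (Suc j)))) (T (num (Suc j)))"
    unfolding limit_augmentation_def Let_def essential_family_def KP_inf_def unstable_degree
  proof (intro conjI ballI)
    show "T (num (Suc j)) = expansion_min
        (\<lambda>i a. stable_value ?\<rho> (\<theta> j) a + times_nat i (u (Q (num (Suc j))))) (Q (num (Suc j)))"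
      using in_\<Delta> stable_value
      by (intro expansion_min_eq_truncation[symmetric] valuation_u degree_Q_pos) (auto simp: d_def)
    show "Q (num (Suc j)) \<in> {f. monic f \<and> \<not> stable ?\<rho> (\<theta> j) f \<and> degree f = d}"
      using unstable abkp[OF in_\<Delta>(2)] by (simp add: d_def abkp_def)
  qed (use continuous unstable degree_less \<theta> unreached in \<open>auto simp: T_eq\<close>)
  moreover have "deg_Phi (T (num j)) (T (num (Suc j))) = degree (Q (num j))"
  proof -
    obtain i where i: "i \<in> \<theta> j" using nonempty by blast
    show ?thesis
    proof (rule deg_Phi_truncation)
      show "monic (Q i)" using abkp[OF \<theta>(1)[OF i]] by (simp add: abkp_def)
      have "T (num (Suc j)) (Q i) = u (Q i)"
        using low[of "num (Suc j)" "Q i"] in_\<Delta> \<theta>(4)[OF i] degree_less by (simp add: d_def)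
      then show "T (num j) (Q i) < T (num (Suc j)) (Q i)"
        using truncation_less[OF abkp[OF in_\<Delta>(1)] abkp[OF \<theta>(1)[OF i]]] \<theta>[OF i]
          increasing[of "num j" i] in_\<Delta> by auto
    qed (use in_\<Delta> \<theta>(4)[OF i] low in \<open>auto intro: truncation_le abkp degree_Q_pos\<close>)
  qed
  moreover have "Q (num j) \<notin> Phi (T (num j)) (T (num (Suc j)))"
    using truncation_self[OF abkp[OF in_\<Delta>(1)]] truncation_le[OF abkp[OF in_\<Delta>(2)], of "Q (num j)"]
    by (auto simp: Phi_def)
  ultimately show ?thesis
    using deg_val_truncation[OF abkp[OF in_\<Delta>(1)]] by simp
qed

lemma truncations_form_chain:
  defines "S \<equiv> \<lambda>j. if \<theta> j = {} then Ordinary else Limit (\<theta> j) Q (\<lambda>i. u (Q i))"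
  shows "complete_finite_mlv_chain v N (\<lambda>j. T (num j)) (\<lambda>j. Q (num j)) (\<lambda>j. u (Q (num j))) S"
proof -
  have "is_mlv_step (S j) (T (num j)) (Q (num j)) (Q (num (Suc j))) (u (Q (num (Suc j))))
      (T (num (Suc j)))" if "j < N" for j
    using ordinary_step[OF that] limit_step[OF that] by (simp add: S_def)
  moreover have "abkp wbar (Q (num 0))" by (intro abkp num_in) simp
  ultimately show ?thesis
    unfolding complete_finite_mlv_chain_def finite_mlv_chain_def
    using depth_zero_truncation_X
    by (simp add: valuation_truncation abkp num_in abkp_in_KP_truncation deg_val_truncation
        truncation_self flip: Q_0)
qed

end

theorem theorem2p38:
  fixes v :: "'k::field \<Rightarrow> 'g::linordered_ab_group_add extended"
    and w :: "'k poly fract \<Rightarrow> 'g extended"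
    and vbar :: "'k alg_closure \<Rightarrow> 'g extended"
    and wbar :: "'k alg_closure poly fract \<Rightarrow> 'g extended"
    and \<Delta> :: "'i::linorder set" and I :: "nat set"
    and num :: "nat \<Rightarrow> 'i" and \<theta> :: "nat \<Rightarrow> 'i set" and Q :: "'i \<Rightarrow> 'k poly" and N :: nat
  assumes "common_extension v w vbar wbar"
    and "standard_complete_set (on_polys w) wbar \<Delta> I num \<theta> Q"
    and "N \<in> I" and "\<forall>i\<in>\<Delta>. i \<le> num N"
  shows "\<exists>(W :: nat \<Rightarrow> 'k poly \<Rightarrow> 'g extended) (\<gamma> :: nat \<Rightarrow> 'g extended)
            (S :: nat \<Rightarrow> ('i, 'k poly, 'g) mlv_step).
           W 0 = truncation (on_polys w) (Q (num 0)) \<and>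
           W N = on_polys w \<and>
           complete_finite_mlv_chain v N W (\<lambda>j. Q (num j)) \<gamma> S \<and>
           (\<forall>j<N.
              (\<theta> j = {} \<longrightarrow>
                 S j = Ordinary \<and>
                 W (Suc j) = truncation (on_polys w) (Q (num (Suc j))) \<and>
                 \<gamma> (Suc j) = on_polys w (Q (num (Suc j)))) \<and>
              (\<theta> j \<noteq> {} \<longrightarrow>
                 (\<exists>A \<chi> \<beta>. S j = Limit A \<chi> \<beta>) \<and>
                 W (Suc j) = truncation (on_polys w) (Q (num (Suc j))) \<and>
                 \<gamma> (Suc j) = on_polys w (Q (num (Suc j)))))"
proof -
  interpret complete_set_with_last v w vbar wbar \<Delta> I num \<theta> Q N
    using assms by unfold_locales (simp_all add: standard_complete_set_def)
  show ?thesis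
    using truncations_form_chain T_last
    by (intro exI[of _ "\<lambda>j. T (num j)"] exI[of _ "\<lambda>j. u (Q (num j))"]
        exI[of _ "\<lambda>j. if \<theta> j = {} then Ordinary else Limit (\<theta> j) Q (\<lambda>i. u (Q i))"]) auto
qed

end
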